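(* Suppose the standing assumptions (A)-(C) and the stochastic gradient assumptions (S) in the context hold, and that $\mathcal{A}$ is surjective. Let $\{x^k\}$ be produced by the Riemannian smoothing stochastic gradient method with epochs described in the context, applied to $$\min_{x\in\mathcal{M}}\ \mathbb{E}_{\xi\sim\mathcal{D}}[f(x,\xi)]+h(\mathcal{A}x),$$ and set $\hat{x}^{k}=x^{k}-\mathcal{A}^{\dagger}\bigl(\mathcal{A}x^{k}-\mathrm{prox}_{\mu_k h}(\mathcal{A}x^{k})\bigr)$. Then, given $\epsilon>0$, for some $k'=O(\epsilon^{-5})$ (the implied constant not depending on $\epsilon$) one has $$\mathbb{E}\Bigl[\mathrm{dist}\Bigl(0,\ \mathcal{P}_{T_{x^{k'}}\mathcal{M}}\bigl(\nabla f(\hat{x}^{k'})+\mathcal{A}^{*}\partial h(\mathcal{A}\hat{x}^{k'})\bigr)\Bigr)\Bigr]\le\epsilon,\qquad \|x^{k'}-\hat{x}^{k'}\|\le\epsilon .$$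
   Context: Setting and standing assumptions. (A) $\mathcal{M}$ is a compact Riemannian submanifold embedded in $\mathbb{R}^n$ (with the Euclidean inner product on tangent spaces $T_x\mathcal{M}$); $\mathcal{P}_{T_x\mathcal{M}}$ is the orthogonal projection onto $T_x\mathcal{M}$. (B) $f(x):=\mathbb{E}_{\xi\sim\mathcal{D}}[f(x,\xi)]$ is continuously differentiable on $\mathbb{R}^n$ with $\ell_{\nabla f}$-Lipschitz gradient $\nabla f$, not necessarily convex; $h:\mathbb{R}^m\to\mathbb{R}$ is $\rho$-weakly convex ($h+\frac{\rho}{2}\|\cdot\|^2$ is convex), with $\rho>0$, and $\ell_h$-Lipschitz continuous, not necessarily smooth; $\mathcal{A}:\mathbb{R}^n\to\mathbb{R}^m$ is linear (nonzero), with adjoint $\mathcal{A}^*$ and operator norm $\|\mathcal{A}\|$; $\varphi(x)=f(x)+h(\mathcal{A}x)$ is bounded from below. (C) $\mathcal{R}:T\mathcal{M}\to\mathcal{M}$ is a retraction (a smooth map whose restrictions $\mathcal{R}_x$ to $T_x\mathcal{M}$ satisfy $\mathcal{R}_x(0_x)=x$, $d\mathcal{R}_x(0_x)=\mathrm{id}$), and there are constants $\alpha,\beta>0$ with $\|\mathcal{R}_x(u)-x\|\le\alpha\|u\|$ and $\|\mathcal{R}_x(u)-x-u\|\le\beta\|u\|^2$ for all $x\in\mathcal{M}$, $u\in T_x\mathcal{M}$. (S) The samples used are independent and identically distributed with distribution $\mathcal{D}$; for any $x$ a sample $\xi\sim\mathcal{D}$ yields a stochastic gradient $\nabla f(x,\xi)$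 with $\mathbb{E}_\xi[\nabla f(x,\xi)]=\nabla f(x)$ and $\mathbb{E}_\xi[\|\nabla f(x,\xi)-\nabla f(x)\|^2]\le\sigma^2$ for some $\sigma>0$. Notation. $\partial h$ is the limiting subdifferential. For $\mu\in(0,\rho^{-1})$, $h_\mu(y)=\inf_z\{h(z)+\frac{1}{2\mu}\|z-y\|^2\}$ is the Moreau envelope and $\mathrm{prox}_{\mu h}(y)=\arg\min_z\{h(z)+\frac{1}{2\mu}\|z-y\|^2\}$. For parameters $\mu_k$, $F_k(x)=f(x)+h_{\mu_k}(\mathcal{A}x)$, and $$\mathrm{grad}\,F_k(x,\xi)=\mathcal{P}_{T_x\mathcal{M}}\Bigl(\nabla f(x,\xi)+\tfrac{1}{\mu_k}\mathcal{A}^*(\mathcal{A}x-\mathrm{prox}_{\mu_kh}(\mathcal{A}x))\Bigr).$$ $G$ is a finite constant with $\|\nabla F_k(x)\|\le G$ for all $x\in\mathcal{M}$ and all $k\ge1$. $\mathrm{dist}(x,C)=\min_{y\in C}\|x-y\|$, and $\mathcal{P}_{T_x\mathcal{M}}(\nabla f(y)+\mathcal{A}^*\partial h(z))$ is the set $\{\mathcal{P}_{T_x\mathcal{M}}(\nabla f(y)+\mathcal{A}^*\zeta):\zeta\in\partial h(z)\}$. For surjective $\mathcal{A}$, $\mathcal{A}^\dagger=\mathcal{A}^*(\mathcal{A}\mathcal{A}^* )^{-1}$. Constants: $\omega_1=\alpha^2\ell_{\nabla f}+2G\beta+2\rho\alpha^2\|\mathcal{A}\|^2$, $\omega_4=2\rho\alpha^2\|\mathcal{A}\|^2$,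 $\omega=2\omega_1^{-1}\omega_4^3$. Riemannian smoothing stochastic gradient method with epochs. Input $x^1\in\mathcal{M}$, $\epsilon>0$. For $l=0,1,2,\dots$: for $k=2^l,\dots,2^{l+1}-1$: sample $\xi_k\sim\mathcal{D}$ (independent of earlier samples), set $\mu_k=(2\rho)^{-1}k^{-1/5}$, $\ell_k=\alpha^2\ell_{\nabla f}+\alpha^2\|\mathcal{A}\|^2\mu_k^{-1}+2G\beta$, stepsize $\gamma_k=\omega/\ell_k^3$, and $$x^{k+1}=\mathcal{R}_{x^k}(-\gamma_k\,\mathrm{grad}\,F_k(x^k,\xi_k));$$ at the end of epoch $l$ sample $R_l\in\{2^l,\dots,2^{l+1}-1\}$ with $\mathrm{Prob}(R_l=k)=\dfrac{2\gamma_k-\ell_k\gamma_k^2}{\sum_{j=2^l}^{2^{l+1}-1}(2\gamma_j-\ell_j\gamma_j^2)}$. The expectation is over all random choices of the method. *)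

theory Defs
  imports "HOL-Probability.Probability"
begin

text \<open>The next two notions are meant for open sets. On a finite-dimensional space, continuity of all
  iterated directional derivatives is the usual notion of being \<open>k\<close> times continuously
  differentiable.\<close>

primrec Ck_on :: "nat \<Rightarrow> ('a::real_normed_vector \<Rightarrow> 'b::real_normed_vector) \<Rightarrow> 'a set \<Rightarrow> bool" where
  "Ck_on 0 f U \<longleftrightarrow> continuous_on U f"
| "Ck_on (Suc k) f U \<longleftrightarrow>
     (\<forall>x\<in>U. f differentiable (at x)) \<and> (\<forall>v. Ck_on k (\<lambda>x. frechet_derivative f (at x) v) U)"

definition smooth_on :: "'a::real_normed_vector set \<Rightarrow> ('a \<Rightarrow> 'b::real_normed_vector) \<Rightarrow> bool" where
  "smooth_on U f \<longleftrightarrow> (\<forall>k. Ck_on k f U)"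

text \<open>Local slice charts: \<open>\<phi>\<close> is a diffeomorphism between open sets of the ambient space that
  flattens \<open>M\<close> onto a linear subspace of dimension \<open>d\<close>.\<close>

definition embedded_submanifold :: "nat \<Rightarrow> 'a::euclidean_space set \<Rightarrow> bool" where
  "embedded_submanifold d M \<longleftrightarrow>
     (\<forall>x\<in>M. \<exists>U (V :: 'a set) \<phi> \<psi> E. open U \<and> open V \<and> x \<in> U \<and>
        homeomorphism U V \<phi> \<psi> \<and> smooth_on U \<phi> \<and> smooth_on V \<psi> \<and>
        subspace E \<and> dim E = d \<and> \<phi> ` (M \<inter> U) = V \<inter> E)"

definition tangent_space :: "'a::euclidean_space set \<Rightarrow> 'a \<Rightarrow> 'a set" where
  "tangent_space M x = {v. \<exists>(c :: real \<Rightarrow> 'a) e. e > 0 \<and> smooth_on {-e<..<e} c \<and>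
      c ` {-e<..<e} \<subseteq> M \<and> c 0 = x \<and> (c has_vector_derivative v) (at 0)}"

definition orth_proj :: "'a::euclidean_space set \<Rightarrow> 'a \<Rightarrow> 'a" where
  "orth_proj T v = (THE w. w \<in> T \<and> (\<forall>t\<in>T. orthogonal (v - w) t))"

text \<open>Smoothness on the tangent bundle, a subset of the product of the ambient space with itself, is
  the existence of local smooth extensions. Values of \<open>R x u\<close> with \<open>u\<close> not tangent at \<open>x\<close> are
  irrelevant.\<close>

definition manifold_retraction :: "'a::euclidean_space set \<Rightarrow> ('a \<Rightarrow> 'a \<Rightarrow> 'a) \<Rightarrow> bool" where
  "manifold_retraction M R \<longleftrightarrow>
     (\<forall>x\<in>M. \<forall>u\<in>tangent_space M x. R x u \<in> M) \<and>
     (\<forall>x\<in>M. \<forall>u\<in>tangent_space M x. \<exists>W g. open W \<and> (x, u) \<in> W \<and> smooth_on W g \<and>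
        (\<forall>y\<in>M. \<forall>v\<in>tangent_space M y. (y, v) \<in> W \<longrightarrow> g (y, v) = R y v)) \<and>
     (\<forall>x\<in>M. R x 0 = x) \<and>
     (\<forall>x\<in>M. (R x has_derivative (\<lambda>u. u)) (at 0 within tangent_space M x))"

definition gradient :: "('a::real_inner \<Rightarrow> real) \<Rightarrow> 'a \<Rightarrow> 'a" where
  "gradient f x = (THE D. GDERIV f x :> D)"

definition weakly_convex :: "real \<Rightarrow> ('b::euclidean_space \<Rightarrow> real) \<Rightarrow> bool" where
  "weakly_convex \<rho> h \<longleftrightarrow> convex_on UNIV (\<lambda>z. h z + \<rho> / 2 * (norm z)\<^sup>2)"

definition regular_subdiff :: "('b::euclidean_space \<Rightarrow> real) \<Rightarrow> 'b \<Rightarrow> 'b set" where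
  "regular_subdiff h x =
     {v. \<forall>e>0. \<forall>\<^sub>F y in at x. h y \<ge> h x + inner v (y - x) - e * norm (y - x)}"

definition limiting_subdiff :: "('b::euclidean_space \<Rightarrow> real) \<Rightarrow> 'b \<Rightarrow> 'b set" where
  "limiting_subdiff h x =
     {v. \<exists>X V. X \<longlonglongrightarrow> x \<and> (\<lambda>n. h (X n)) \<longlonglongrightarrow> h x \<and>
           (\<forall>n. V n \<in> regular_subdiff h (X n)) \<and> V \<longlonglongrightarrow> v}"

definition moreau_env :: "real \<Rightarrow> ('b::euclidean_space \<Rightarrow> real) \<Rightarrow> 'b \<Rightarrow> real" where
  "moreau_env \<mu> h y = (INF z. h z + 1 / (2 * \<mu>) * (norm (z - y))\<^sup>2)"

definition prox :: "real \<Rightarrow> ('b::euclidean_space \<Rightarrow> real) \<Rightarrow> 'b \<Rightarrow> 'b" where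
  "prox \<mu> h y = (ARG_MIN (\<lambda>z. h z + 1 / (2 * \<mu>) * (norm (z - y))\<^sup>2) z. True)"

text \<open>\<open>A\<^sup>* (A A\<^sup>*)\<^sup>-\<^sup>1\<close>; meaningful for surjective linear \<open>A\<close>, where \<open>A A\<^sup>*\<close> is bijective.\<close>

definition right_pinv :: "('a::euclidean_space \<Rightarrow> 'b::euclidean_space) \<Rightarrow> 'b \<Rightarrow> 'a" where
  "right_pinv A y = adjoint A (inv (A \<circ> adjoint A) y)"

definition prox_point ::
    "('a::euclidean_space \<Rightarrow> 'b::euclidean_space) \<Rightarrow> ('b \<Rightarrow> real) \<Rightarrow> real \<Rightarrow> 'a \<Rightarrow> 'a" where
  "prox_point A h \<mu> x = x - right_pinv A (A x - prox \<mu> h (A x))"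

definition smoothed ::
    "('a::euclidean_space \<Rightarrow> real) \<Rightarrow> ('b::euclidean_space \<Rightarrow> real) \<Rightarrow> ('a \<Rightarrow> 'b) \<Rightarrow> real \<Rightarrow> 'a \<Rightarrow> real"
  where "smoothed f h A \<mu> x = f x + moreau_env \<mu> h (A x)"

text \<open>Here \<open>g\<close> is the stochastic gradient of the smooth part at \<open>x\<close>.\<close>

definition stoch_rgrad ::
    "'a::euclidean_space set \<Rightarrow> ('b::euclidean_space \<Rightarrow> real) \<Rightarrow> ('a \<Rightarrow> 'b) \<Rightarrow> real \<Rightarrow> 'a \<Rightarrow> 'a \<Rightarrow> 'a"
  where "stoch_rgrad M h A \<mu> x g =
    orth_proj (tangent_space M x) (g + (1 / \<mu>) *\<^sub>R adjoint A (A x - prox \<mu> h (A x)))"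

text \<open>The distance of \<open>0\<close> to the projection onto the tangent space at \<open>x\<close> of
  \<open>\<nabla>f y + A\<^sup>* \<partial>h z\<close>. The set is nonempty for the functions \<open>h\<close> considered (finite-valued and weakly
  convex), so the convention \<open>infdist 0 {} = 0\<close> plays no role.\<close>

definition stationarity_gap ::
    "'a::euclidean_space set \<Rightarrow> ('a \<Rightarrow> real) \<Rightarrow> ('b::euclidean_space \<Rightarrow> real) \<Rightarrow> ('a \<Rightarrow> 'b) \<Rightarrow>
      'a \<Rightarrow> 'a \<Rightarrow> 'b \<Rightarrow> real"
  where "stationarity_gap M f h A x y z =
    infdist 0 {orth_proj (tangent_space M x) (gradient f y + adjoint A \<zeta>) | \<zeta>. \<zeta> \<in> limiting_subdiff h z}"

definition epoch :: "nat \<Rightarrow> nat set" where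
  "epoch l = {2 ^ l ..< 2 ^ (l + 1)}"

text \<open>Mutual independence of all random choices: the samples
  \<open>\<xi> k\<close> (\<open>k \<ge> 1\<close>), i.i.d. with law \<open>D\<close>, and the epoch indices \<open>R l\<close>.\<close>

definition independent_choices ::
    "'w measure \<Rightarrow> 's measure \<Rightarrow> (nat \<Rightarrow> 'w \<Rightarrow> 's) \<Rightarrow> (nat \<Rightarrow> 'w \<Rightarrow> nat) \<Rightarrow> bool" where
  "independent_choices P D \<xi> R \<longleftrightarrow>
     prob_space.indep_vars P (\<lambda>_. D) \<xi> {1..} \<and>
     (\<forall>k\<ge>1. distr P D (\<xi> k) = D) \<and>
     prob_space.indep_vars P (\<lambda>_. count_space UNIV) R UNIV \<and>
     prob_space.indep_set P
       {(\<lambda>w. \<lambda>k\<in>{1..}. \<xi> k w) -` B \<inter> space P | B. B \<in> sets (Pi\<^sub>M {1..} (\<lambda>_. D))}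
       {(\<lambda>w l. R l w) -` B \<inter> space P | B. B \<in> sets (Pi\<^sub>M UNIV (\<lambda>_. count_space UNIV))}"

text \<open>\<open>R l\<close> takes each value \<open>k\<close> in its epoch with probability \<open>wt k / sum wt (epoch l)\<close>. The
  division is cleared so that the (only possible) degenerate case of a vanishing denominator, \<open>l = 0\<close>
  with \<open>epoch 0 = {1}\<close> and \<open>wt 1 = 0\<close>, does not make the condition contradictory.\<close>

definition epoch_index :: "'w measure \<Rightarrow> (nat \<Rightarrow> real) \<Rightarrow> nat \<Rightarrow> ('w \<Rightarrow> nat) \<Rightarrow> bool" where
  "epoch_index P wt l \<kappa> \<longleftrightarrow>
     (\<forall>w\<in>space P. \<kappa> w \<in> epoch l) \<and>
     (\<forall>k\<in>epoch l. measure P {w \<in> space P. \<kappa> w = k} * (\<Sum>j\<in>epoch l. wt j) = wt k)"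

end

theory Submission
  imports Defs
begin

text \<open>
  Why the bound holds. Fix an epoch \<open>l \<ge> 1\<close> and put \<open>s = 2 powr (- l / 5)\<close>; on this epoch the
  smoothing parameters are at most \<open>s / (2 * \<rho>)\<close>. The Moreau envelope is an infimum of quadratics of
  curvature \<open>1 / \<mu>\<close>, so it lies below a quadratic of that curvature which touches it at a given point
  (\<open>moreau_env_upper_quadratic\<close>). Composing with \<open>A\<close> and with the retraction, the smoothed objective
  \<open>F k\<close> satisfies a descent inequality along tangent vectors with constant \<open>lip k\<close>
  (\<open>smoothed_retraction_step\<close>). The sample used in step \<open>k\<close> is independent of \<open>x k\<close>, so its noise is
  centred given \<open>x k\<close> and has second moment at most \<open>\<sigma>\<^sup>2\<close> (\<open>centred_noise_expectations\<close>). With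
  \<open>V k\<close> the expected squared norm of the Riemannian gradient of \<open>F k\<close> at \<open>x k\<close>, and \<open>wt k\<close> the
  unnormalised probability of the index \<open>k\<close>, this reads
  \<open>wt k * V k \<le> 2 * (e k - e (k + 1)) + lip k * (\<gamma> k)\<^sup>2 * \<sigma>\<^sup>2 + const * (\<mu> k - \<mu> (k + 1))\<close>, where
  \<open>e k\<close> is the expectation of \<open>F k (x k)\<close> and the last term pays for the change of the smoothing parameter.

  Summation over one epoch. The differences telescope, and \<open>F k\<close> is bounded on the compact set \<open>M\<close>
  uniformly in \<open>k\<close>, so they contribute a constant that does not depend on \<open>l\<close>. The noise terms are
  \<open>O(1 / k)\<close>, and an epoch has \<open>2 ^ l\<close> indices that are all at least \<open>2 ^ l\<close>; hence they contribute a
  constant as well, and the logarithm that a sum over all steps would produce does not appear. The weights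
  are of order \<open>k powr (- 3 / 5)\<close>, so they add up to at least \<open>c / s\<^sup>2\<close>. The weighted average of
  \<open>V k\<close> over the epoch is therefore \<open>O(s\<^sup>2)\<close>.

  From the gradient to the stationarity gap. The scaled residual of the proximal point is a subgradient of
  \<open>h\<close> at that point, and \<open>A\<close> maps \<open>xhat\<close> exactly there. So the gap at \<open>x k\<close> exceeds the norm of the
  Riemannian gradient by at most a multiple of \<open>norm (x k - xhat)\<close>, which is \<open>O(s)\<close>
  (\<open>stationarity_gap_le\<close>, \<open>norm_prox_point_diff_le\<close>). Since \<open>r \<le> r\<^sup>2 / (2 * s) + s / 2\<close>, the weighted
  average of the expected gaps is \<open>O(s)\<close>. The index \<open>R l\<close> is drawn with these weights independently of
  the iterates, so this average is the expected gap at the random index, and some fixed index of the epoch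
  does at least as well. Choosing \<open>l\<close> with \<open>C0 * s \<le> \<epsilon>\<close> costs indices of size \<open>O(1 / \<epsilon> ^ 5)\<close>.

  The expectations only make sense once the iterates and the gap are measurable. For this the projection
  onto the tangent space is shown to be continuous in the base point and the vector jointly, and the gap to
  be lower semicontinuous on \<open>M\<close>, because the limiting subdifferential of a Lipschitz function is bounded and
  has a closed graph.
\<close>

section \<open>Tangent spaces in slice charts\<close>

lemma Ck_on_cong:
  assumes "open U" "\<And>x. x \<in> U \<Longrightarrow> f x = g x" "Ck_on k f U"
  shows "Ck_on k g U"
  using assms(2,3)
proof (induction k arbitrary: f g)
  case 0
  then show ?case by (simp cong: continuous_on_cong)
next
  case (Suc k)
  have "g differentiable (at x)" if "x \<in> U" for x
  proof -
    have "f differentiable (at x)" using Suc.prems(2) that by simp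
    then obtain f' where "(f has_derivative f') (at x)" unfolding differentiable_def by blast
    then have "(g has_derivative f') (at x)"
      using has_derivative_transform_within_open[OF _ assms(1) that] Suc.prems(1) by blast
    then show ?thesis unfolding differentiable_def by blast
  qed
  moreover have "frechet_derivative f (at x) = frechet_derivative g (at x)" if "x \<in> U" for x
    using Suc.prems assms(1) that
    by (intro frechet_derivative_transform_within_open[of f x U g]) auto
  moreover have "Ck_on k (\<lambda>x. frechet_derivative g (at x) v) U" for v
  proof (rule Suc.IH)
    show "Ck_on k (\<lambda>x. frechet_derivative f (at x) v) U" using Suc.prems(2) by simp
  qed (use calculation(2) in simp)
  ultimately show ?case by simp
qed

text \<open>Reparametrising along an affine line keeps smoothness. This is all that is needed to see that the image
  under a chart of a straight segment is a smooth curve in the manifold.\<close>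

lemma Ck_on_compose_line:
  assumes "Ck_on k g V" "open V" "open I" "\<And>t::real. t \<in> I \<Longrightarrow> a + t *\<^sub>R e \<in> V"
  shows "Ck_on k (\<lambda>t. g (a + t *\<^sub>R e)) I"
  using assms(1)
proof (induction k arbitrary: g)
  case 0
  then show ?case
    using assms(4) by (auto intro!: continuous_intros continuous_on_compose2[of V g])
next
  case (Suc k)
  have der: "((\<lambda>t. g (a + t *\<^sub>R e)) has_derivative
      (\<lambda>s. frechet_derivative g (at (a + t *\<^sub>R e)) (s *\<^sub>R e))) (at t)" if "t \<in> I" for t
  proof (rule has_derivative_compose[where f="\<lambda>t. a + t *\<^sub>R e" and g=g and f'="\<lambda>s. s *\<^sub>R e"])
    show "((\<lambda>t. a + t *\<^sub>R e) has_derivative (\<lambda>s. s *\<^sub>R e)) (at t)"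
      by (auto intro!: derivative_eq_intros)
    show "(g has_derivative frechet_derivative g (at (a + t *\<^sub>R e))) (at (a + t *\<^sub>R e))"
      using Suc.prems assms(4)[OF that] by (simp add: frechet_derivative_works[symmetric])
  qed
  have "Ck_on k (\<lambda>t. frechet_derivative (\<lambda>t. g (a + t *\<^sub>R e)) (at t) s) I" for s
  proof (rule Ck_on_cong[OF assms(3)])
    show "Ck_on k (\<lambda>t. frechet_derivative g (at (a + t *\<^sub>R e)) (s *\<^sub>R e)) I"
      using Suc.prems by (intro Suc.IH) simp
  qed (use frechet_derivative_at[OF der] in metis)
  moreover have "(\<lambda>t. g (a + t *\<^sub>R e)) differentiable (at t)" if "t \<in> I" for t
    using der[OF that] unfolding differentiable_def by blast
  ultimately show ?case by simp
qed

lemma smooth_onD: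
  assumes "smooth_on U f"
  shows "continuous_on U f"
    and "x \<in> U \<Longrightarrow> (f has_derivative frechet_derivative f (at x)) (at x)"
    and "continuous_on U (\<lambda>x. frechet_derivative f (at x) v)"
proof -
  have "Ck_on 0 f U" "Ck_on (Suc 0) f U" using assms unfolding smooth_on_def by blast+
  then show "continuous_on U f" "continuous_on U (\<lambda>x. frechet_derivative f (at x) v)"
    "x \<in> U \<Longrightarrow> (f has_derivative frechet_derivative f (at x)) (at x)"
    by (auto simp: frechet_derivative_works[symmetric])
qed

text \<open>The derivative is continuous in the point and the direction together: in finite dimension it is a finite
  combination of the partial derivatives, whose continuity is part of smoothness.\<close>

lemma smooth_on_frechet_derivative_tendsto:
  fixes f :: "'a::euclidean_space \<Rightarrow> 'b::real_normed_vector"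
  assumes "smooth_on U f" "open U" "y \<in> U" "(u \<longlongrightarrow> y) F" "(v \<longlongrightarrow> w) F"
  shows "((\<lambda>n. frechet_derivative f (at (u n)) (v n)) \<longlongrightarrow> frechet_derivative f (at y) w) F"
proof -
  define L where "L x b = frechet_derivative f (at x) b" for x b
  have lin: "L x v = (\<Sum>b\<in>Basis. (v \<bullet> b) *\<^sub>R L x b)" if "x \<in> U" for x v
  proof -
    have "linear (L x)"
      using smooth_onD(2)[OF assms(1) that] has_derivative_linear unfolding L_def by blast
    then have "L x (\<Sum>b\<in>Basis. (v \<bullet> b) *\<^sub>R b) = (\<Sum>b\<in>Basis. (v \<bullet> b) *\<^sub>R L x b)"
      by (simp add: linear_sum linear_cmul)
    then show ?thesis by (simp add: euclidean_representation)
  qed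
  have "((\<lambda>n. \<Sum>b\<in>Basis. (v n \<bullet> b) *\<^sub>R L (u n) b) \<longlongrightarrow> (\<Sum>b\<in>Basis. (w \<bullet> b) *\<^sub>R L y b)) F"
  proof (intro tendsto_intros assms)
    fix b
    have "isCont (\<lambda>x. L x b) y"
      using smooth_onD(3)[OF assms(1)] assms(2,3) continuous_on_eq_continuous_at unfolding L_def by blast
    then show "((\<lambda>n. L (u n) b) \<longlongrightarrow> L y b) F"
      using assms(4) isCont_tendsto_compose by blast
  qed
  moreover have "eventually (\<lambda>n. u n \<in> U) F"
    using assms(2-4) topological_tendstoD by blast
  then have "\<forall>\<^sub>F n in F. (\<Sum>b\<in>Basis. (v n \<bullet> b) *\<^sub>R L (u n) b) = L (u n) (v n)"
    by (rule eventually_mono) (simp only: lin[symmetric])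
  ultimately have "((\<lambda>n. L (u n) (v n)) \<longlongrightarrow> (\<Sum>b\<in>Basis. (w \<bullet> b) *\<^sub>R L y b)) F"
    by (rule Lim_transform_eventually)
  then show ?thesis using lin[OF assms(3), of w] by (simp only: L_def)
qed

text \<open>A slice chart identifies the tangent space with the flat model space \<open>E\<close>. Velocities of curves in
  \<open>M\<close> are sent into \<open>E\<close> because the image curve runs in \<open>E\<close>, which is closed; conversely each direction in
  \<open>E\<close> is realised by the preimage of a straight segment. The first description is stable under limits of
  tangent vectors, the second produces tangent vectors at nearby points.\<close>

lemma tangent_space_slice_chart:
  fixes M V E :: "'a::euclidean_space set"
  assumes U: "open U" and V: "open V" and hom: "homeomorphism U V \<phi> \<psi>"
    and smooth: "smooth_on U \<phi>" "smooth_on V \<psi>"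
    and E: "subspace E" "\<phi> ` (M \<inter> U) = V \<inter> E" and y: "y \<in> M \<inter> U"
  shows "tangent_space M y = {v. frechet_derivative \<phi> (at y) v \<in> E}"
    and "tangent_space M y = frechet_derivative \<psi> (at (\<phi> y)) ` E"
proof -
  define d\<phi> where "d\<phi> = frechet_derivative \<phi> (at y)"
  define d\<psi> where "d\<psi> = frechet_derivative \<psi> (at (\<phi> y))"
  have yV: "\<phi> y \<in> V" "\<phi> y \<in> E" using E(2) y by blast+
  have inv: "\<psi> (\<phi> z) = z" if "z \<in> U" for z using hom that unfolding homeomorphism_def by blast
  have d\<phi>: "(\<phi> has_derivative d\<phi>) (at y)" and d\<psi>: "(\<psi> has_derivative d\<psi>) (at (\<phi> y))"
    using smooth_onD(2)[OF smooth(1)] smooth_onD(2)[OF smooth(2)] y yV unfolding d\<phi>_def d\<psi>_def by auto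
  have d\<psi>d\<phi>: "d\<psi> (d\<phi> v) = v" for v
  proof -
    have "((\<lambda>z. \<psi> (\<phi> z)) has_derivative (\<lambda>v. d\<psi> (d\<phi> v))) (at y)"
      by (rule has_derivative_compose[OF d\<phi> d\<psi>])
    then have "((\<lambda>z. z) has_derivative (\<lambda>v. d\<psi> (d\<phi> v))) (at y)"
      using U y inv by (auto elim!: has_derivative_transform_within_open[of _ _ _ _ U])
    then show ?thesis using has_derivative_unique has_derivative_ident by metis
  qed
  have sub1: "d\<phi> v \<in> E" if v: "v \<in> tangent_space M y" for v
  proof -
    obtain c e where c: "e > 0" "c ` {-e<..<e} \<subseteq> M" "c 0 = y" "(c has_vector_derivative v) (at 0)"
      using v unfolding tangent_space_def by blast
    have "isCont c 0" using c(4) has_vector_derivative_continuous by blast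
    then have "(c \<longlongrightarrow> c 0) (nhds 0)"
      unfolding isCont_def by (simp add: tendsto_at_iff_tendsto_nhds)
    then have "\<forall>\<^sub>F t in nhds 0. c t \<in> U"
      using U y c(3) by (auto dest: topological_tendstoD)
    then obtain r where r: "r > 0" "\<And>t. \<bar>t\<bar> < r \<Longrightarrow> c t \<in> U"
      unfolding eventually_nhds_metric by (auto simp: dist_real_def)
    have "((\<lambda>t. \<phi> (c t)) has_derivative (\<lambda>s. d\<phi> (s *\<^sub>R v))) (at 0)"
      using c(3,4) d\<phi> unfolding has_vector_derivative_def
      by (intro has_derivative_compose[where f=c and g=\<phi>]) auto
    moreover have "linear d\<phi>" using d\<phi> has_derivative_linear by blast
    ultimately have der: "((\<lambda>t. \<phi> (c t)) has_vector_derivative d\<phi> v) (at 0)"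
      unfolding has_vector_derivative_def by (simp add: linear_cmul)
    have "d\<phi> v \<in> orthogonal_comp (orthogonal_comp E)"
      unfolding orthogonal_comp_def[of "orthogonal_comp E"]
    proof clarify
      fix u assume u: "u \<in> orthogonal_comp E"
      have zero: "u \<bullet> \<phi> (c t) = 0" if "t \<in> {-min e r<..<min e r}" for t
      proof -
        have "c t \<in> M \<inter> U" using that r(2)[of t] c(2) by (auto simp: abs_less_iff)
        then have "\<phi> (c t) \<in> E" using E(2) by blast
        then show ?thesis
          using u unfolding orthogonal_comp_def by (auto simp: orthogonal_def inner_commute)
      qed
      have "((\<lambda>t. u \<bullet> \<phi> (c t)) has_vector_derivative u \<bullet> d\<phi> v) (at 0)"
        using bounded_linear.has_vector_derivative[OF bounded_linear_inner_right der] .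
      then have "((\<lambda>t. 0) has_vector_derivative u \<bullet> d\<phi> v) (at (0::real))"
        using c(1) r(1) zero
        by (auto elim!: has_vector_derivative_transform_within_open[where S="{-min e r<..<min e r}"])
      then have "u \<bullet> d\<phi> v = 0"
        using vector_derivative_unique_at has_vector_derivative_const by metis
      then show "orthogonal u (d\<phi> v)" by (simp add: orthogonal_def)
    qed
    then show ?thesis using orthogonal_comp_self[OF E(1)] by simp
  qed
  have sub2: "d\<psi> e \<in> tangent_space M y" if e: "e \<in> E" for e
  proof -
    have "((\<lambda>t::real. \<phi> y + t *\<^sub>R e) \<longlongrightarrow> \<phi> y + 0 *\<^sub>R e) (nhds 0)"
      by (intro tendsto_intros filterlim_ident)
    then have "\<forall>\<^sub>F t::real in nhds 0. \<phi> y + t *\<^sub>R e \<in> V"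
      using V yV(1) topological_tendstoD by fastforce
    then obtain r where r: "r > 0" "\<And>t::real. \<bar>t\<bar> < r \<Longrightarrow> \<phi> y + t *\<^sub>R e \<in> V"
      unfolding eventually_nhds_metric by (auto simp: dist_real_def)
    define c where "c t = \<psi> (\<phi> y + t *\<^sub>R e)" for t :: real
    have "smooth_on {-r<..<r} c"
      unfolding smooth_on_def c_def
      using smooth(2) r V by (auto simp: smooth_on_def intro!: Ck_on_compose_line[where V=V])
    moreover have "c t \<in> M" if "\<bar>t\<bar> < r" for t
    proof -
      have "\<phi> y + t *\<^sub>R e \<in> E"
        using E(1) yV(2) e by (simp add: subspace_add subspace_scale)
      then have "\<phi> y + t *\<^sub>R e \<in> \<phi> ` (M \<inter> U)" using r(2)[OF that] by (simp only: E(2) IntI)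
      then obtain z where z: "z \<in> M \<inter> U" "\<phi> y + t *\<^sub>R e = \<phi> z" by (rule imageE) blast
      then show ?thesis using inv[of z] unfolding c_def z(2) by simp
    qed
    moreover have "c 0 = y" using inv y unfolding c_def by simp
    moreover have "(c has_vector_derivative d\<psi> e) (at 0)"
    proof -
      have "(c has_derivative (\<lambda>s. d\<psi> (s *\<^sub>R e))) (at 0)"
        unfolding c_def
        by (rule has_derivative_compose[where f="\<lambda>t. \<phi> y + t *\<^sub>R e" and g=\<psi>])
          (auto intro!: derivative_eq_intros simp: d\<psi>)
      moreover have "linear d\<psi>" using d\<psi> has_derivative_linear by blast
      ultimately show ?thesis unfolding has_vector_derivative_def by (simp add: linear_cmul)
    qed
    ultimately show ?thesis
      using r(1) unfolding tangent_space_def by (intro CollectI exI[of _ c] exI[of _ r]) auto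
  qed
  show "tangent_space M y = {v. d\<phi> v \<in> E}"
  proof (intro equalityI subsetI CollectI)
    fix v assume "v \<in> {v. d\<phi> v \<in> E}"
    then show "v \<in> tangent_space M y" using sub2[of "d\<phi> v"] d\<psi>d\<phi>[of v] by simp
  qed (rule sub1)
  show "tangent_space M y = d\<psi> ` E"
  proof (intro equalityI subsetI)
    fix v assume "v \<in> tangent_space M y"
    then show "v \<in> d\<psi> ` E" using sub1 d\<psi>d\<phi>[of v] by (intro image_eqI[of _ _ "d\<phi> v"]) auto
  qed (use sub2 in blast)
qed

lemma slice_chart_obtain:
  fixes M :: "'a::euclidean_space set"
  assumes "embedded_submanifold d M" "y \<in> M"
  obtains U and V :: "'a set" and \<phi> \<psi> E where "open U" "open V" "y \<in> U" "homeomorphism U V \<phi> \<psi>"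
    "smooth_on U \<phi>" "smooth_on V \<psi>" "subspace E" "\<phi> ` (M \<inter> U) = V \<inter> E"
  using assms unfolding embedded_submanifold_def by (metis (no_types))

lemma subspace_tangent_space:
  fixes M :: "'a::euclidean_space set"
  assumes "embedded_submanifold d M" "y \<in> M"
  shows "subspace (tangent_space M y)"
proof -
  obtain U and V :: "'a set" and \<phi> \<psi> E where c: "open U" "open V" "y \<in> U" "homeomorphism U V \<phi> \<psi>"
    "smooth_on U \<phi>" "smooth_on V \<psi>" "subspace E" "\<phi> ` (M \<inter> U) = V \<inter> E"
    using slice_chart_obtain[OF assms] .
  have "linear (frechet_derivative \<phi> (at y))"
    using smooth_onD(2)[OF c(5,3)] has_derivative_linear by blast
  then have "subspace (frechet_derivative \<phi> (at y) -` E)"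
    using c(7) by (rule linear_subspace_vimage)
  then show ?thesis
    using tangent_space_slice_chart(1)[OF c(1,2,4-8)] assms(2) c(3) by (simp add: vimage_def)
qed

text \<open>Tangency is a closed condition, by the first description of the tangent space in a chart.\<close>

lemma tangent_space_limit:
  fixes M :: "'a::euclidean_space set"
  assumes "embedded_submanifold d M" "y \<in> M" "\<And>n. u n \<in> M" "u \<longlonglongrightarrow> y"
    "\<And>n. v n \<in> tangent_space M (u n)" "v \<longlonglongrightarrow> w"
  shows "w \<in> tangent_space M y"
proof -
  obtain U and V :: "'a set" and \<phi> \<psi> E where c: "open U" "open V" "y \<in> U" "homeomorphism U V \<phi> \<psi>"
    "smooth_on U \<phi>" "smooth_on V \<psi>" "subspace E" "\<phi> ` (M \<inter> U) = V \<inter> E"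
    using slice_chart_obtain[OF assms(1,2)] .
  have "\<forall>\<^sub>F n in sequentially. u n \<in> U"
    using assms(4) c(1,3) by (rule topological_tendstoD)
  then have "\<forall>\<^sub>F n in sequentially. frechet_derivative \<phi> (at (u n)) (v n) \<in> E"
    by (rule eventually_mono)
      (use tangent_space_slice_chart(1)[OF c(1,2,4-8)] assms(3,5) in blast)
  moreover have "(\<lambda>n. frechet_derivative \<phi> (at (u n)) (v n)) \<longlonglongrightarrow> frechet_derivative \<phi> (at y) w"
    using smooth_on_frechet_derivative_tendsto[OF c(5,1,3) assms(4,6)] .
  ultimately have "frechet_derivative \<phi> (at y) w \<in> E"
    by (intro Lim_in_closed_set[OF closed_subspace[OF c(7)] _ trivial_limit_sequentially])
  then show ?thesis
    using tangent_space_slice_chart(1)[OF c(1,2,4-8)] assms(2) c(3) by blast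
qed

text \<open>Transporting the same model vector by the inverse chart extends a tangent vector continuously to
  nearby points.\<close>

lemma tangent_space_approx:
  fixes M :: "'a::euclidean_space set"
  assumes "embedded_submanifold d M" "y \<in> M" "\<And>n. u n \<in> M" "u \<longlonglongrightarrow> y" "w \<in> tangent_space M y"
  obtains v where "\<forall>\<^sub>F n in sequentially. v n \<in> tangent_space M (u n)" "v \<longlonglongrightarrow> w"
proof -
  obtain U and V :: "'a set" and \<phi> \<psi> E where c: "open U" "open V" "y \<in> U" "homeomorphism U V \<phi> \<psi>"
    "smooth_on U \<phi>" "smooth_on V \<psi>" "subspace E" "\<phi> ` (M \<inter> U) = V \<inter> E"
    using slice_chart_obtain[OF assms(1,2)] .
  have T: "tangent_space M z = frechet_derivative \<psi> (at (\<phi> z)) ` E" if "z \<in> M \<inter> U" for z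
    using tangent_space_slice_chart(2)[OF c(1,2,4-8) that] .
  obtain e where e: "e \<in> E" "w = frechet_derivative \<psi> (at (\<phi> y)) e"
    using T[of y] assms(2,5) c(3) by auto
  define v where "v n = frechet_derivative \<psi> (at (\<phi> (u n))) e" for n
  have "isCont \<phi> y"
    using smooth_onD(1)[OF c(5)] c(1,3) continuous_on_eq_continuous_at by blast
  then have "(\<lambda>n. \<phi> (u n)) \<longlonglongrightarrow> \<phi> y" using assms(4) isCont_tendsto_compose by blast
  moreover have "\<phi> y \<in> V" using c(8,3) assms(2) by blast
  ultimately have "v \<longlonglongrightarrow> w"
    unfolding v_def e(2) using c(2,6) by (intro smooth_on_frechet_derivative_tendsto tendsto_const)
  moreover have "\<forall>\<^sub>F n in sequentially. u n \<in> U"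
    using assms(4) c(1,3) by (rule topological_tendstoD)
  then have "\<forall>\<^sub>F n in sequentially. v n \<in> tangent_space M (u n)"
    by (rule eventually_mono) (use T assms(3) e(1) v_def in auto)
  ultimately show thesis using that by blast
qed

section \<open>Projection onto tangent spaces\<close>

lemma orth_proj_unique:
  fixes T :: "'a::euclidean_space set"
  assumes "subspace T" "w \<in> T" "\<And>t. t \<in> T \<Longrightarrow> (v - w) \<bullet> t = 0"
  shows "orth_proj T v = w"
  unfolding orth_proj_def
proof (rule the_equality)
  fix w' assume w': "w' \<in> T \<and> (\<forall>t\<in>T. orthogonal (v - w') t)"
  then have "w - w' \<in> T" using assms(1,2) subspace_diff by blast
  then have "(v - w') \<bullet> (w - w') = 0" "(v - w) \<bullet> (w - w') = 0"
    using w' assms(3) by (auto simp: orthogonal_def)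
  then have "(w - w') \<bullet> (w - w') = 0" by (simp add: inner_diff_left)
  then show "w' = w" by simp
qed (use assms(2,3) in \<open>simp add: orthogonal_def\<close>)

lemma orth_proj:
  fixes T :: "'a::euclidean_space set"
  assumes "subspace T"
  shows "orth_proj T v \<in> T" and "t \<in> T \<Longrightarrow> orth_proj T v \<bullet> t = v \<bullet> t"
proof -
  obtain y z where yz: "y \<in> span T" "\<And>w. w \<in> span T \<Longrightarrow> orthogonal z w" "v = y + z"
    using orthogonal_subspace_decomp_exists[of T v] by blast
  have "orth_proj T v = y"
    using yz assms by (intro orth_proj_unique) (auto simp: orthogonal_def span_eq_iff[THEN iffD2])
  then show "orth_proj T v \<in> T" "t \<in> T \<Longrightarrow> orth_proj T v \<bullet> t = v \<bullet> t"
    using yz assms by (auto simp: orthogonal_def inner_add_left span_eq_iff[THEN iffD2])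
qed

lemma orth_proj_add:
  assumes "subspace T"
  shows "orth_proj T (v + w) = orth_proj T v + orth_proj T w"
  using assms orth_proj[OF assms]
  by (intro orth_proj_unique) (auto simp: subspace_add inner_diff_left inner_add_left)

lemma norm_orth_proj_le:
  assumes "subspace T"
  shows "norm (orth_proj T v) \<le> norm v"
proof -
  have "(norm (orth_proj T v))\<^sup>2 = v \<bullet> orth_proj T v"
    using orth_proj(2)[OF assms orth_proj(1)[OF assms]] by (simp add: power2_norm_eq_inner)
  also have "\<dots> \<le> norm v * norm (orth_proj T v)" by (rule norm_cauchy_schwarz)
  finally show ?thesis
    by (cases "norm (orth_proj T v) = 0") (simp_all add: power2_eq_square)
qed

text \<open>The projections are bounded, so it suffices to identify their accumulation points. By
  \<open>tangent_space_limit\<close> an accumulation point is tangent at the limit, and by \<open>tangent_space_approx\<close> the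
  orthogonality relations pass to the limit; these two properties characterise the projection.\<close>

lemma orth_proj_tangent_space_tendsto:
  fixes M :: "'a::euclidean_space set"
  assumes M: "embedded_submanifold d M" "y \<in> M" "\<And>n. u n \<in> M" "u \<longlonglongrightarrow> y" and v: "v \<longlonglongrightarrow> w"
  shows "(\<lambda>n. orth_proj (tangent_space M (u n)) (v n)) \<longlonglongrightarrow> orth_proj (tangent_space M y) w"
proof (rule ccontr)
  let ?p = "\<lambda>n. orth_proj (tangent_space M (u n)) (v n)" and ?l = "orth_proj (tangent_space M y) w"
  have sub: "subspace (tangent_space M z)" if "z \<in> M" for z using subspace_tangent_space M(1) that by blast
  assume "\<not> ?p \<longlonglongrightarrow> ?l"
  then obtain e where e: "e > 0" "\<not> (\<forall>\<^sub>F n in sequentially. dist (?p n) ?l < e)"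
    unfolding tendsto_iff by blast
  then obtain r :: "nat \<Rightarrow> nat" where r: "strict_mono r" "\<forall>n. \<not> dist (?p (r n)) ?l < e"
    using not_eventually_sequentiallyD[OF e(2)] by blast
  obtain B where B: "\<And>n. norm (v n) \<le> B"
    using v convergent_imp_Bseq[of v] by (auto simp: convergent_def Bseq_def)
  have "norm (?p n) \<le> B" for n
    using norm_orth_proj_le[OF sub[OF M(3)]] B order_trans by blast
  then have "bounded (range (\<lambda>n. ?p (r n)))" unfolding bounded_iff by blast
  then obtain l s where s: "strict_mono s" "((\<lambda>n. ?p (r n)) \<circ> s) \<longlonglongrightarrow> l"
    using bounded_imp_convergent_subsequence by blast
  let ?q = "\<lambda>n. r (s n)"
  have q: "strict_mono ?q" using r(1) s(1) by (simp add: strict_mono_def)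
  have uq: "(\<lambda>n. u (?q n)) \<longlonglongrightarrow> y" and vq: "(\<lambda>n. v (?q n)) \<longlonglongrightarrow> w"
    using LIMSEQ_subseq_LIMSEQ[OF M(4) q] LIMSEQ_subseq_LIMSEQ[OF v q] by (simp_all add: o_def)
  have pq: "(\<lambda>n. ?p (?q n)) \<longlonglongrightarrow> l" using s(2) by (simp add: o_def)
  have "?l = l"
  proof (rule orth_proj_unique[OF sub[OF M(2)]])
    show "l \<in> tangent_space M y"
      using tangent_space_limit[OF M(1,2,3) uq _ pq] orth_proj(1)[OF sub[OF M(3)]] by blast
    fix t assume "t \<in> tangent_space M y"
    then obtain \<tau> where \<tau>: "\<forall>\<^sub>F n in sequentially. \<tau> n \<in> tangent_space M (u (?q n))" "\<tau> \<longlonglongrightarrow> t"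
      using tangent_space_approx[OF M(1,2) M(3) uq] by blast
    have "(\<lambda>n. (v (?q n) - ?p (?q n)) \<bullet> \<tau> n) \<longlonglongrightarrow> (w - l) \<bullet> t"
      by (intro tendsto_intros vq pq \<tau>)
    moreover have "\<forall>\<^sub>F n in sequentially. (v (?q n) - ?p (?q n)) \<bullet> \<tau> n = 0"
      using \<tau>(1) by (rule eventually_mono) (simp add: inner_diff_left orth_proj(2)[OF sub[OF M(3)]])
    ultimately have "(\<lambda>n. 0::real) \<longlonglongrightarrow> (w - l) \<bullet> t" by (rule Lim_transform_eventually)
    then show "(w - l) \<bullet> t = 0" using LIMSEQ_unique tendsto_const by metis
  qed
  then have "\<forall>\<^sub>F n in sequentially. dist (?p (?q n)) ?l < e"
    using pq e(1) tendstoD by metis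
  then obtain n where "dist (?p (?q n)) ?l < e"
    unfolding eventually_sequentially by blast
  then show False using r(2) by blast
qed

lemma continuous_on_orth_proj_tangent_space:
  fixes M :: "'a::euclidean_space set"
  assumes "embedded_submanifold d M"
  shows "continuous_on (M \<times> UNIV) (\<lambda>(y, v). orth_proj (tangent_space M y) v)"
  unfolding continuous_on_sequentially
proof clarsimp
  fix z :: "nat \<Rightarrow> 'a \<times> 'a" and y w
  assume z: "y \<in> M" "\<forall>n. z n \<in> M \<times> UNIV" "z \<longlonglongrightarrow> (y, w)"
  have "fst (z n) \<in> M" for n using z(2) by (simp only: mem_Times_iff)
  then have "(\<lambda>n. orth_proj (tangent_space M (fst (z n))) (snd (z n))) \<longlonglongrightarrow> orth_proj (tangent_space M y) w"
    using tendsto_fst[OF z(3)] tendsto_snd[OF z(3)] unfolding fst_conv snd_conv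
    by (intro orth_proj_tangent_space_tendsto[OF assms z(1)])
  then show "((\<lambda>(y, v). orth_proj (tangent_space M y) v) \<circ> z) \<longlonglongrightarrow> orth_proj (tangent_space M y) w"
    by (simp only: o_def case_prod_beta)
qed

lemma continuous_on_retraction:
  assumes "manifold_retraction M Retr"
  shows "continuous_on (SIGMA y:M. tangent_space M y) (\<lambda>(y, u). Retr y u)"
  unfolding continuous_on_eq_continuous_within
proof clarify
  fix y u assume yu: "y \<in> M" "u \<in> tangent_space M y"
  let ?T = "SIGMA y:M. tangent_space M y"
  have "\<forall>x\<in>M. \<forall>u\<in>tangent_space M x. \<exists>W g. open W \<and> (x, u) \<in> W \<and> smooth_on W g \<and>
      (\<forall>y\<in>M. \<forall>v\<in>tangent_space M y. (y, v) \<in> W \<longrightarrow> g (y, v) = Retr y v)"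
    using assms unfolding manifold_retraction_def by (rule conjunct1[OF conjunct2])
  from bspec[OF bspec[OF this yu(1)] yu(2)] obtain W g where W: "open W" "(y, u) \<in> W" "smooth_on W g"
    and g: "\<And>y v. y \<in> M \<Longrightarrow> v \<in> tangent_space M y \<Longrightarrow> (y, v) \<in> W \<Longrightarrow> g (y, v) = Retr y v"
    by metis
  have "isCont g (y, u)"
    using smooth_onD(1)[OF W(3)] W(1,2) continuous_on_eq_continuous_at by blast
  then have "(g \<longlongrightarrow> g (y, u)) (at (y, u) within ?T)"
    unfolding isCont_def by (rule tendsto_within_subset) simp
  moreover have "\<forall>\<^sub>F z in at (y, u) within ?T. g z = (case z of (y, v) \<Rightarrow> Retr y v)"
    unfolding eventually_at_topological using W(1,2) g by (intro exI[of _ W]) auto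
  ultimately have "((\<lambda>(y, v). Retr y v) \<longlongrightarrow> g (y, u)) (at (y, u) within ?T)"
    by (rule Lim_transform_eventually)
  then show "continuous (at (y, u) within ?T) (\<lambda>(y, v). Retr y v)"
    using g[OF yu W(2)] by (simp add: continuous_within)
qed

section \<open>Gradients\<close>

text \<open>A first-order model with a quadratic error is the derivative; this is how the envelope is
  differentiated below.\<close>

lemma has_derivative_quadratic_remainder:
  fixes f :: "'a::real_normed_vector \<Rightarrow> 'b::real_normed_vector"
  assumes "bounded_linear f'" "\<And>y. norm (f y - f x - f' (y - x)) \<le> K * (norm (y - x))\<^sup>2"
  shows "(f has_derivative f') (at x)"
proof (rule has_derivativeI_sandwich[where e=1 and H="\<lambda>y. K * norm (y - x)"])
  fix y assume "y \<noteq> x"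
  then show "norm (f y - f x - f' (y - x)) / norm (y - x) \<le> K * norm (y - x)"
    using assms(2)[of y] by (simp add: divide_le_eq power2_eq_square mult.assoc)
next
  have "((\<lambda>y. K * norm (y - x)) \<longlongrightarrow> K * norm (x - x)) (at x)"
    by (intro tendsto_intros)
  then show "((\<lambda>y. K * norm (y - x)) \<longlongrightarrow> 0) (at x)" by simp
qed (use assms(1) in auto)

lemma gradient_eqI:
  assumes g: "GDERIV f x :> g"
  shows "gradient f x = g"
  unfolding gradient_def
proof (rule the_equality)
  show "GDERIV f x :> g" by (rule g)
next
  fix g' assume "GDERIV f x :> g'"
  then have "(\<lambda>h. h \<bullet> g') = (\<lambda>h. h \<bullet> g)"
    using g unfolding gderiv_def by (rule has_derivative_unique)
  then have "(g' - g) \<bullet> g' = (g' - g) \<bullet> g" by metis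
  then have "(g' - g) \<bullet> (g' - g) = 0" by (simp add: inner_diff_right)
  then show "g' = g" by simp
qed

lemma GDERIV_gradient:
  fixes f :: "'a::euclidean_space \<Rightarrow> real"
  assumes "f differentiable (at x)"
  shows "GDERIV f x :> gradient f x"
proof -
  obtain f' where f': "(f has_derivative f') (at x)" using assms unfolding differentiable_def by blast
  have "f' = (\<lambda>h. h \<bullet> adjoint f' 1)"
    using adjoint_works[OF has_derivative_linear[OF f'], of _ 1] by auto
  then have "GDERIV f x :> adjoint f' 1" using f' unfolding gderiv_def by simp
  then show ?thesis using gradient_eqI by metis
qed

section \<open>Moreau envelopes of weakly convex Lipschitz functions\<close>

text \<open>The identity behind strong convexity of the squared distance.\<close>

lemma norm_diff_scale_convex_combination:
  fixes p z y :: "'a::real_inner"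
  shows "(norm (p + t *\<^sub>R (z - p) - y))\<^sup>2
    = (1 - t) * (norm (p - y))\<^sup>2 + t * (norm (z - y))\<^sup>2 - t * (1 - t) * (norm (z - p))\<^sup>2"
  unfolding power2_norm_eq_inner
  by (simp add: inner_diff_left inner_diff_right inner_add_left inner_add_right inner_commute algebra_simps)

context
  fixes h :: "'b::euclidean_space \<Rightarrow> real" and lh \<mu> :: real
  assumes lip: "lh-lipschitz_on UNIV h" and \<mu>: "\<mu> > 0"
begin

lemma lipschitz_abs_diff_le: "\<bar>h a - h b\<bar> \<le> lh * norm (a - b)"
  using lipschitz_onD[OF lip, of a b] by (simp add: dist_norm)

lemma prox_minimizes:
  "h (prox \<mu> h y) + 1 / (2 * \<mu>) * (norm (prox \<mu> h y - y))\<^sup>2 \<le> h z + 1 / (2 * \<mu>) * (norm (z - y))\<^sup>2"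
proof -
  let ?\<Psi> = "\<lambda>z. h z + 1 / (2 * \<mu>) * (norm (z - y))\<^sup>2"
  have lh: "lh \<ge> 0" using lip lipschitz_on_nonneg by blast
  have "continuous_on (cball y (2 * \<mu> * lh)) ?\<Psi>"
    by (intro continuous_intros continuous_on_subset[OF lipschitz_on_continuous_on[OF lip]]) auto
  then obtain p where p: "\<And>z. z \<in> cball y (2 * \<mu> * lh) \<Longrightarrow> ?\<Psi> p \<le> ?\<Psi> z"
    using continuous_attains_inf[of "cball y (2 * \<mu> * lh)" ?\<Psi>] lh \<mu>
    by (metis (no_types, lifting) cball_eq_empty compact_cball mult_nonneg_nonneg not_less less_imp_le zero_le_numeral)
  have "?\<Psi> p \<le> ?\<Psi> z" for z
  proof (cases "z \<in> cball y (2 * \<mu> * lh)")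
    case False
    \<comment> \<open>outside the ball the quadratic term already exceeds the possible decrease of \<open>h\<close>\<close>
    then have "2 * \<mu> * lh \<le> norm (z - y)" by (simp add: dist_norm norm_minus_commute)
    then have "2 * \<mu> * lh * norm (z - y) \<le> (norm (z - y))\<^sup>2"
      unfolding power2_eq_square by (rule mult_right_mono) simp
    then have "lh * norm (z - y) \<le> 1 / (2 * \<mu>) * (norm (z - y))\<^sup>2"
      using \<mu> by (simp add: field_simps)
    moreover have "?\<Psi> p \<le> h y" using p[of y] lh \<mu> by simp
    ultimately show ?thesis using lipschitz_abs_diff_le[of z y] by linarith
  qed (rule p)
  then have "is_arg_min ?\<Psi> (\<lambda>_. True) p" by (simp add: is_arg_min_linorder)
  then have "is_arg_min ?\<Psi> (\<lambda>_. True) (prox \<mu> h y)"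
    unfolding prox_def arg_min_def by (rule someI)
  then show ?thesis by (simp add: is_arg_min_linorder)
qed

text \<open>Comparing the proximal point with its centre, the quadratic penalty is paid for by a decrease of
  \<open>h\<close>, which is at most linear in the distance.\<close>

lemma norm_prox_diff_le: "norm (y - prox \<mu> h y) \<le> 2 * \<mu> * lh"
proof (cases "y = prox \<mu> h y")
  case True
  then show ?thesis using \<mu> lipschitz_on_nonneg[OF lip] by (metis cancel_comm_monoid_add_class.diff_cancel less_eq_real_def mult_nonneg_nonneg norm_zero zero_le_numeral)
next
  case False
  let ?p = "prox \<mu> h y"
  have "1 / (2 * \<mu>) * (norm (?p - y))\<^sup>2 \<le> lh * norm (?p - y)"
    using prox_minimizes[of y y] lipschitz_abs_diff_le[of ?p y] by simp
  then have "norm (?p - y) * norm (?p - y) \<le> (2 * \<mu> * lh) * norm (?p - y)"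
    using \<mu> by (simp add: field_simps power2_eq_square)
  then show ?thesis using False by (simp add: norm_minus_commute)
qed

lemma moreau_env_prox: "moreau_env \<mu> h y = h (prox \<mu> h y) + 1 / (2 * \<mu>) * (norm (prox \<mu> h y - y))\<^sup>2"
  unfolding moreau_env_def using prox_minimizes by (intro cInf_eq_minimum) blast+

lemma moreau_env_le: "moreau_env \<mu> h y \<le> h z + 1 / (2 * \<mu>) * (norm (z - y))\<^sup>2"
  unfolding moreau_env_prox by (rule prox_minimizes)

lemma moreau_env_bounds: "h y - 2 * \<mu> * lh\<^sup>2 \<le> moreau_env \<mu> h y" "moreau_env \<mu> h y \<le> h y"
proof -
  have "lh * norm (y - prox \<mu> h y) \<le> lh * (2 * \<mu> * lh)"
    using norm_prox_diff_le lipschitz_on_nonneg[OF lip] by (rule mult_left_mono)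
  then have "lh * norm (y - prox \<mu> h y) \<le> 2 * \<mu> * lh\<^sup>2"
    by (simp add: power2_eq_square algebra_simps)
  then have "h y - h (prox \<mu> h y) \<le> 2 * \<mu> * lh\<^sup>2"
    using lipschitz_abs_diff_le[of y "prox \<mu> h y"] by linarith
  moreover have "0 \<le> 1 / (2 * \<mu>) * (norm (prox \<mu> h y - y))\<^sup>2" using \<mu> by simp
  ultimately show "h y - 2 * \<mu> * lh\<^sup>2 \<le> moreau_env \<mu> h y" unfolding moreau_env_prox by linarith
  show "moreau_env \<mu> h y \<le> h y" using moreau_env_le[of y y] by simp
qed

text \<open>Inserting the minimiser for \<open>y\<close> as a competitor at \<open>y'\<close> gives this one-sided bound directly, with
  the sharp curvature and without differentiating.\<close>

lemma moreau_env_upper_quadratic: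
  "moreau_env \<mu> h y' \<le> moreau_env \<mu> h y + (1 / \<mu>) * ((y - prox \<mu> h y) \<bullet> (y' - y)) + 1 / (2 * \<mu>) * (norm (y' - y))\<^sup>2"
proof -
  let ?p = "prox \<mu> h y"
  have "(norm (?p - y'))\<^sup>2 = (norm (?p - y))\<^sup>2 + 2 * ((y - ?p) \<bullet> (y' - y)) + (norm (y' - y))\<^sup>2"
    unfolding power2_norm_eq_inner
    by (simp add: inner_diff_left inner_diff_right inner_commute algebra_simps)
  then have "1 / (2 * \<mu>) * (norm (?p - y'))\<^sup>2
      = 1 / (2 * \<mu>) * (norm (?p - y))\<^sup>2 + (1 / \<mu>) * ((y - ?p) \<bullet> (y' - y)) + 1 / (2 * \<mu>) * (norm (y' - y))\<^sup>2"
    using \<mu> by (simp add: field_simps)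
  then show ?thesis using moreau_env_le[of y' ?p] unfolding moreau_env_prox[of y] by linarith
qed

text \<open>The optimality condition of the proximal problem. It holds in the sense of regular subgradients because
  the error is quadratic in the distance.\<close>

lemma prox_residual_subgradient: "(1 / \<mu>) *\<^sub>R (y - prox \<mu> h y) \<in> regular_subdiff h (prox \<mu> h y)"
  unfolding regular_subdiff_def
proof clarify
  let ?p = "prox \<mu> h y" and ?v = "(1 / \<mu>) *\<^sub>R (y - prox \<mu> h y)"
  fix e :: real assume e: "e > 0"
  have "h ?p + ?v \<bullet> (z - ?p) - e * norm (z - ?p) \<le> h z" if "dist z ?p < 2 * \<mu> * e" for z
  proof -
    have "(norm (z - y))\<^sup>2 = (norm (?p - y))\<^sup>2 - 2 * ((y - ?p) \<bullet> (z - ?p)) + (norm (z - ?p))\<^sup>2"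
      unfolding power2_norm_eq_inner
      by (simp add: inner_diff_left inner_diff_right inner_commute algebra_simps)
    then have "1 / (2 * \<mu>) * (norm (z - y))\<^sup>2
        = 1 / (2 * \<mu>) * (norm (?p - y))\<^sup>2 - ?v \<bullet> (z - ?p) + 1 / (2 * \<mu>) * (norm (z - ?p))\<^sup>2"
      using \<mu> unfolding inner_scaleR_left by (simp add: field_simps)
    moreover have "1 / (2 * \<mu>) * (norm (z - ?p))\<^sup>2 \<le> e * norm (z - ?p)"
    proof -
      have "norm (z - ?p) * norm (z - ?p) \<le> (2 * \<mu> * e) * norm (z - ?p)"
        using that by (intro mult_right_mono) (auto simp: dist_norm)
      then show ?thesis using \<mu> by (simp add: field_simps power2_eq_square)
    qed
    ultimately show ?thesis using prox_minimizes[of y z] by linarith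
  qed
  moreover have "0 < 2 * \<mu> * e" using e \<mu> by simp
  ultimately show "\<forall>\<^sub>F z in at ?p. h z \<ge> h ?p + ?v \<bullet> (z - ?p) - e * norm (z - ?p)"
    unfolding eventually_at by blast
qed

context
  fixes \<rho> :: real
  assumes weak: "weakly_convex \<rho> h" and \<rho>\<mu>: "\<mu> * \<rho> < 1"
begin

text \<open>The proximal objective is strongly convex with modulus \<open>1 / \<mu> - \<rho>\<close>, the convexity of the penalty
  minus the weak convexity of \<open>h\<close>. Growth at the minimiser follows by comparing it with points of the
  segment to \<open>z\<close> that approach it.\<close>

lemma prox_quadratic_growth:
  "h (prox \<mu> h y) + 1 / (2 * \<mu>) * (norm (prox \<mu> h y - y))\<^sup>2 + (1 / \<mu> - \<rho>) / 2 * (norm (z - prox \<mu> h y))\<^sup>2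
    \<le> h z + 1 / (2 * \<mu>) * (norm (z - y))\<^sup>2"
proof -
  let ?p = "prox \<mu> h y" and ?\<Psi> = "\<lambda>z. h z + 1 / (2 * \<mu>) * (norm (z - y))\<^sup>2"
  define K where "K = (1 / \<mu> - \<rho>) / 2 * (norm (z - ?p))\<^sup>2"
  have bound: "?\<Psi> ?p + K * (1 - t) \<le> ?\<Psi> z" if t: "0 < t" "t < 1" for t
  proof -
    define q where "q = ?p + t *\<^sub>R (z - ?p)"
    have q: "q = (1 - t) *\<^sub>R ?p + t *\<^sub>R z" unfolding q_def by (simp add: algebra_simps)
    have "h q + \<rho> / 2 * (norm q)\<^sup>2 \<le> (1 - t) * (h ?p + \<rho> / 2 * (norm ?p)\<^sup>2) + t * (h z + \<rho> / 2 * (norm z)\<^sup>2)"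
      using weak t convex_onD[of UNIV "\<lambda>z. h z + \<rho> / 2 * (norm z)\<^sup>2" t ?p z]
      unfolding weakly_convex_def q by simp
    moreover have nq: "(norm q)\<^sup>2 = (1 - t) * (norm ?p)\<^sup>2 + t * (norm z)\<^sup>2 - t * (1 - t) * (norm (z - ?p))\<^sup>2"
      unfolding q_def using norm_diff_scale_convex_combination[of ?p t z 0] by simp
    have "\<rho> / 2 * (norm q)\<^sup>2 = (1 - t) * (\<rho> / 2 * (norm ?p)\<^sup>2) + t * (\<rho> / 2 * (norm z)\<^sup>2)
        - \<rho> / 2 * (t * (1 - t) * (norm (z - ?p))\<^sup>2)"
      unfolding nq by (simp add: field_simps)
    ultimately have hq: "h q \<le> (1 - t) * h ?p + t * h z + \<rho> / 2 * (t * (1 - t) * (norm (z - ?p))\<^sup>2)"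
      by (simp only: distrib_left)
    have "?\<Psi> ?p \<le> ?\<Psi> q" by (rule prox_minimizes)
    also have "\<dots> \<le> (1 - t) * h ?p + t * h z + \<rho> / 2 * (t * (1 - t) * (norm (z - ?p))\<^sup>2)
        + 1 / (2 * \<mu>) * ((1 - t) * (norm (?p - y))\<^sup>2 + t * (norm (z - y))\<^sup>2 - t * (1 - t) * (norm (z - ?p))\<^sup>2)"
      using hq unfolding q_def norm_diff_scale_convex_combination by simp
    also have "\<dots> = ?\<Psi> ?p - t * ?\<Psi> ?p + t * ?\<Psi> z - t * (K * (1 - t))"
      using \<mu> unfolding K_def by (simp add: field_simps)
    finally have "t * (?\<Psi> ?p + K * (1 - t)) \<le> t * ?\<Psi> z" by (simp add: distrib_left)
    then show ?thesis using t(1) by simp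
  qed
  have "((\<lambda>t. ?\<Psi> ?p + K * (1 - t)) \<longlongrightarrow> ?\<Psi> ?p + K * (1 - 0)) (at_right 0)"
    by (intro tendsto_intros)
  moreover have "\<forall>\<^sub>F t in at_right 0. ?\<Psi> ?p + K * (1 - t) \<le> ?\<Psi> z"
    unfolding eventually_at_right_field using bound by (intro exI[of _ 1]) auto
  ultimately have "?\<Psi> ?p + K * (1 - 0) \<le> ?\<Psi> z"
    by (rule tendsto_upperbound) simp
  then show ?thesis unfolding K_def by simp
qed

text \<open>Add the growth inequalities at the two proximal points, each tested at the other one.\<close>

lemma prox_lipschitz: "norm (prox \<mu> h y - prox \<mu> h y') \<le> norm (y - y') / (1 - \<mu> * \<rho>)"
proof (cases "prox \<mu> h y = prox \<mu> h y'")
  case True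
  then show ?thesis using \<rho>\<mu> by simp
next
  case False
  let ?p = "prox \<mu> h y" and ?p' = "prox \<mu> h y'"
  have "(1 / \<mu> - \<rho>) * (norm (?p - ?p'))\<^sup>2
      \<le> 1 / (2 * \<mu>) * ((norm (?p' - y))\<^sup>2 - (norm (?p - y))\<^sup>2 + (norm (?p - y'))\<^sup>2 - (norm (?p' - y'))\<^sup>2)"
    using prox_quadratic_growth[of y ?p'] prox_quadratic_growth[of y' ?p]
    by (simp add: norm_minus_commute[of ?p' ?p] algebra_simps add_divide_distrib diff_divide_distrib)
  also have "(norm (?p' - y))\<^sup>2 - (norm (?p - y))\<^sup>2 + (norm (?p - y'))\<^sup>2 - (norm (?p' - y'))\<^sup>2
      = 2 * ((?p - ?p') \<bullet> (y - y'))"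
    unfolding power2_norm_eq_inner
    by (simp add: inner_diff_left inner_diff_right inner_commute algebra_simps)
  also have "1 / (2 * \<mu>) * (2 * ((?p - ?p') \<bullet> (y - y'))) \<le> 1 / \<mu> * (norm (?p - ?p') * norm (y - y'))"
    using \<mu> norm_cauchy_schwarz[of "?p - ?p'" "y - y'"] by (simp add: divide_right_mono)
  finally have "\<mu> * ((1 / \<mu> - \<rho>) * (norm (?p - ?p'))\<^sup>2) \<le> \<mu> * (1 / \<mu> * (norm (?p - ?p') * norm (y - y')))"
    by (rule mult_left_mono) (use \<mu> in simp)
  moreover have "\<mu> * ((1 / \<mu> - \<rho>) * (norm (?p - ?p'))\<^sup>2) = (1 - \<mu> * \<rho>) * (norm (?p - ?p') * norm (?p - ?p'))"
    using \<mu> by (simp add: field_simps power2_eq_square)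
  moreover have "\<mu> * (1 / \<mu> * (norm (?p - ?p') * norm (y - y'))) = norm (y - y') * norm (?p - ?p')"
    using \<mu> by simp
  ultimately have "(1 - \<mu> * \<rho>) * (norm (?p - ?p') * norm (?p - ?p')) \<le> norm (y - y') * norm (?p - ?p')"
    by linarith
  then have "(1 - \<mu> * \<rho>) * norm (?p - ?p') \<le> norm (y - y')"
    using False by (simp add: mult.assoc[symmetric])
  then show ?thesis using \<rho>\<mu> by (simp add: field_simps)
qed

lemma continuous_on_prox: "continuous_on S (prox \<mu> h)"
proof (rule lipschitz_on_continuous_on[OF lipschitz_onI])
  show "dist (prox \<mu> h y) (prox \<mu> h y') \<le> 1 / (1 - \<mu> * \<rho>) * dist y y'" for y y'
    using prox_lipschitz[of y y'] by (simp add: dist_norm)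
qed (use \<rho>\<mu> in simp)

text \<open>The upper quadratic at \<open>y\<close> bounds the increment from above; the upper quadratic at \<open>y'\<close> bounds it from
  below with the gradient at \<open>y'\<close>, which differs from the one at \<open>y\<close> by a Lipschitz error.\<close>

lemma GDERIV_moreau_env: "GDERIV (moreau_env \<mu> h) y :> (1 / \<mu>) *\<^sub>R (y - prox \<mu> h y)"
  unfolding gderiv_def
proof (rule has_derivative_quadratic_remainder)
  define L where "L = 1 + 1 / (1 - \<mu> * \<rho>)"
  have L: "L \<ge> 1" using \<rho>\<mu> unfolding L_def by simp
  let ?r = "\<lambda>y. y - prox \<mu> h y" and ?e = "moreau_env \<mu> h"
  fix y'
  have "norm (?r y' - ?r y) \<le> norm (y' - y) + norm (prox \<mu> h y' - prox \<mu> h y)"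
    using norm_triangle_ineq4[of "y' - y" "prox \<mu> h y' - prox \<mu> h y"] by (simp add: algebra_simps)
  also have "\<dots> \<le> L * norm (y' - y)"
    using prox_lipschitz[of y' y] unfolding L_def by (simp add: algebra_simps)
  finally have rL: "norm (?r y' - ?r y) \<le> L * norm (y' - y)" .
  have "\<bar>(?r y' - ?r y) \<bullet> (y' - y)\<bar> \<le> norm (?r y' - ?r y) * norm (y' - y)"
    by (rule Cauchy_Schwarz_ineq2)
  also have "\<dots> \<le> L * norm (y' - y) * norm (y' - y)"
    using rL by (rule mult_right_mono) simp
  finally have "\<bar>(1 / \<mu>) * ((?r y' - ?r y) \<bullet> (y' - y))\<bar> \<le> L / \<mu> * (norm (y' - y))\<^sup>2"
    using \<mu> by (simp add: abs_mult power2_eq_square field_simps)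
  then have cross: "- (L / \<mu> * (norm (y' - y))\<^sup>2) \<le> (1 / \<mu>) * (?r y' \<bullet> (y' - y)) - (1 / \<mu>) * (?r y \<bullet> (y' - y))"
    by (simp add: inner_diff_left right_diff_distrib abs_le_iff) 
  have up: "?e y' \<le> ?e y + (1 / \<mu>) * (?r y \<bullet> (y' - y)) + 1 / (2 * \<mu>) * (norm (y' - y))\<^sup>2"
    by (rule moreau_env_upper_quadratic)
  have "?r y' \<bullet> (y - y') = - (?r y' \<bullet> (y' - y))" by (simp add: inner_diff_right)
  then have low: "?e y \<le> ?e y' - (1 / \<mu>) * (?r y' \<bullet> (y' - y)) + 1 / (2 * \<mu>) * (norm (y' - y))\<^sup>2"
    using moreau_env_upper_quadratic[of y y'] by (simp add: norm_minus_commute)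
  have K: "(L + 1) / \<mu> * (norm (y' - y))\<^sup>2 = L / \<mu> * (norm (y' - y))\<^sup>2 + 1 / (2 * \<mu>) * (norm (y' - y))\<^sup>2 + 1 / (2 * \<mu>) * (norm (y' - y))\<^sup>2"
    using \<mu> by (simp add: field_simps)
  have "0 \<le> L / \<mu> * (norm (y' - y))\<^sup>2" "0 \<le> 1 / (2 * \<mu>) * (norm (y' - y))\<^sup>2" using L \<mu> by auto
  then have "\<bar>?e y' - ?e y - (1 / \<mu>) * (?r y \<bullet> (y' - y))\<bar> \<le> (L + 1) / \<mu> * (norm (y' - y))\<^sup>2"
    using up low cross unfolding K abs_le_iff by linarith
  then show "norm (?e y' - ?e y - (y' - y) \<bullet> ((1 / \<mu>) *\<^sub>R ?r y)) \<le> (1 + 1 / (1 - \<mu> * \<rho>) + 1) / \<mu> * (norm (y' - y))\<^sup>2"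
    unfolding L_def by (simp add: inner_commute)
qed (rule bounded_linear_inner_left)

end

end

text \<open>The old minimiser is a competitor for the new envelope, and its distance from the centre is
  \<open>O(\<mu>)\<close>. The bound is linear in \<open>\<mu> - \<mu>'\<close>, so that it telescopes over the steps of the method; this
  needs the two parameters to be comparable.\<close>

lemma moreau_env_decrease_parameter:
  fixes h :: "'b::euclidean_space \<Rightarrow> real"
  assumes "0 < \<mu>'" "\<mu>' \<le> \<mu>" "\<mu> \<le> 2 * \<mu>'" and lip: "lh-lipschitz_on UNIV h"
  shows "moreau_env \<mu>' h y \<le> moreau_env \<mu> h y + 4 * lh\<^sup>2 * (\<mu> - \<mu>')"
proof -
  have \<mu>: "0 < \<mu>" using assms(1,2) by simp
  let ?r = "norm (prox \<mu> h y - y)"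
  have r: "?r\<^sup>2 \<le> 4 * \<mu>\<^sup>2 * lh\<^sup>2"
    using power_mono[OF norm_prox_diff_le[OF lip \<mu>, of y], of 2] by (simp add: norm_minus_commute power_mult_distrib)
  have "(1 / (2 * \<mu>') - 1 / (2 * \<mu>)) * ?r\<^sup>2 = (\<mu> - \<mu>') / (2 * \<mu> * \<mu>') * ?r\<^sup>2"
    using assms(1) \<mu> by (simp add: field_simps)
  also have "\<dots> \<le> (\<mu> - \<mu>') / (2 * \<mu> * \<mu>') * (4 * \<mu>\<^sup>2 * lh\<^sup>2)"
    using assms(1,2) \<mu> r by (intro mult_left_mono) auto
  also have "\<dots> = (\<mu> / \<mu>') * (2 * lh\<^sup>2 * (\<mu> - \<mu>'))"
    using assms(1) \<mu> by (simp add: field_simps power2_eq_square)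
  also have "\<dots> \<le> 2 * (2 * lh\<^sup>2 * (\<mu> - \<mu>'))"
  proof (rule mult_right_mono)
    show "\<mu> / \<mu>' \<le> 2" using assms(1,3) by (simp add: field_simps)
    show "0 \<le> 2 * lh\<^sup>2 * (\<mu> - \<mu>')" using assms(2) by simp
  qed
  finally have "1 / (2 * \<mu>') * ?r\<^sup>2 \<le> 1 / (2 * \<mu>) * ?r\<^sup>2 + 4 * lh\<^sup>2 * (\<mu> - \<mu>')"
    by (simp add: left_diff_distrib)
  then show ?thesis using moreau_env_le[OF lip assms(1), of y "prox \<mu> h y"]
    unfolding moreau_env_prox[OF lip \<mu>, of y] by linarith
qed

section \<open>Limiting subgradients of Lipschitz functions\<close>

lemma regular_subdiff_subset_limiting: "regular_subdiff h x \<subseteq> limiting_subdiff h x"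
proof
  fix v assume "v \<in> regular_subdiff h x"
  then show "v \<in> limiting_subdiff h x"
    unfolding limiting_subdiff_def
    by (intro CollectI exI[of _ "\<lambda>_. x"] exI[of _ "\<lambda>_. v"]) simp
qed

lemma norm_regular_subgradient_le:
  fixes h :: "'b::euclidean_space \<Rightarrow> real"
  assumes lip: "lh-lipschitz_on UNIV h" and v: "v \<in> regular_subdiff h x"
  shows "norm v \<le> lh"
proof (cases "v = 0")
  case True
  then show ?thesis using lipschitz_on_nonneg[OF lip] by simp
next
  case False
  show ?thesis
  proof (rule field_le_epsilon)
    fix e :: real assume "e > 0"
    then have "\<forall>\<^sub>F y in at x. h y \<ge> h x + inner v (y - x) - e * norm (y - x)"
      using v unfolding regular_subdiff_def by blast
    then obtain d where d: "d > 0"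
      "\<And>y. y \<noteq> x \<Longrightarrow> dist y x < d \<Longrightarrow> h y \<ge> h x + inner v (y - x) - e * norm (y - x)"
      unfolding eventually_at by blast
    define t where "t = d / (2 * norm v)"
    have t: "t > 0" "t * norm v < d" using d(1) False unfolding t_def by auto
    have "h (x + t *\<^sub>R v) \<ge> h x + inner v (t *\<^sub>R v) - e * norm (t *\<^sub>R v)"
      using d(2)[of "x + t *\<^sub>R v"] t False by (simp add: dist_norm)
    moreover have "\<bar>h (x + t *\<^sub>R v) - h x\<bar> \<le> lh * norm (t *\<^sub>R v)"
      using lipschitz_onD[OF lip, of "x + t *\<^sub>R v" x] by (simp add: dist_norm)
    ultimately have "(t * norm v) * norm v \<le> (t * norm v) * (lh + e)"
      using t(1) by (simp add: power2_norm_eq_inner[symmetric] power2_eq_square algebra_simps)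
    then show "norm v \<le> lh + e" using t(1) False by simp
  qed
qed

lemma norm_limiting_subgradient_le:
  fixes h :: "'b::euclidean_space \<Rightarrow> real"
  assumes "lh-lipschitz_on UNIV h" "v \<in> limiting_subdiff h x"
  shows "norm v \<le> lh"
proof -
  obtain X V where V: "\<And>n. V n \<in> regular_subdiff h (X n)" "V \<longlonglongrightarrow> v"
    using assms(2) unfolding limiting_subdiff_def by blast
  show ?thesis
    by (rule LIMSEQ_le_const2[OF tendsto_norm[OF V(2)]])
      (use norm_regular_subgradient_le[OF assms(1) V(1)] in blast)
qed

text \<open>A diagonal argument: each \<open>vs n\<close> is approximated by a regular subgradient at a point within
  \<open>1 / (n + 1)\<close> of \<open>zs n\<close>, and these regular subgradients witness the limit.\<close>

lemma limiting_subdiff_closed_graph: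
  fixes h :: "'b::euclidean_space \<Rightarrow> real"
  assumes cont: "isCont h z" and zs: "zs \<longlonglongrightarrow> z" and vs: "vs \<longlonglongrightarrow> v"
    and sub: "\<And>n. vs n \<in> limiting_subdiff h (zs n)"
  shows "v \<in> limiting_subdiff h z"
proof -
  have "\<exists>x w. dist x (zs n) < 1 / real (Suc n) \<and> dist w (vs n) < 1 / real (Suc n) \<and> w \<in> regular_subdiff h x" for n
  proof -
    obtain X V where XV: "X \<longlonglongrightarrow> zs n" "\<And>k. V k \<in> regular_subdiff h (X k)" "V \<longlonglongrightarrow> vs n"
      using sub[of n] unfolding limiting_subdiff_def by blast
    have "0 < 1 / real (Suc n)" by simp
    then have "\<forall>\<^sub>F k in sequentially. dist (X k) (zs n) < 1 / real (Suc n) \<and> dist (V k) (vs n) < 1 / real (Suc n)"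
      using tendstoD[OF XV(1)] tendstoD[OF XV(3)] eventually_conj by blast
    then obtain k where "dist (X k) (zs n) < 1 / real (Suc n) \<and> dist (V k) (vs n) < 1 / real (Suc n)"
      unfolding eventually_sequentially by blast
    then show ?thesis using XV(2) by blast
  qed
  then obtain X V where X: "\<And>n. dist (X n) (zs n) < 1 / real (Suc n)"
    and V: "\<And>n. dist (V n) (vs n) < 1 / real (Suc n)" "\<And>n. V n \<in> regular_subdiff h (X n)" by metis
  have lim: "xs \<longlonglongrightarrow> l" if "ys \<longlonglongrightarrow> l" "\<And>n. dist (xs n) (ys n) < 1 / real (Suc n)" for xs ys and l :: 'b
  proof -
    have "(\<lambda>n. dist (xs n) (ys n)) \<longlonglongrightarrow> 0"
    proof (rule tendsto_sandwich[OF _ _ tendsto_const])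
      show "(\<lambda>n. 1 / real (Suc n)) \<longlonglongrightarrow> 0" using LIMSEQ_inverse_real_of_nat by (simp add: inverse_eq_divide)
      show "\<forall>\<^sub>F n in sequentially. dist (xs n) (ys n) \<le> 1 / real (Suc n)"
        using that(2) less_imp_le by (intro always_eventually) blast
    qed simp
    then have "(\<lambda>n. xs n - ys n) \<longlonglongrightarrow> 0" by (simp add: dist_norm tendsto_norm_zero_iff)
    from tendsto_add[OF this that(1)] show ?thesis by simp
  qed
  have "X \<longlonglongrightarrow> z" "V \<longlonglongrightarrow> v" using lim[OF zs X] lim[OF vs V(1)] .
  moreover from this have "(\<lambda>n. h (X n)) \<longlonglongrightarrow> h z" using cont isCont_tendsto_compose by blast
  ultimately show ?thesis
    unfolding limiting_subdiff_def using V(2)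
    by (intro CollectI exI[of _ X] exI[of _ V]) blast
qed

section \<open>The smoothed composite objective\<close>

lemma lipschitz_gradient_upper_quadratic:
  fixes f :: "'a::euclidean_space \<Rightarrow> real"
  assumes diff: "\<And>y. f differentiable (at y)" and lip: "L-lipschitz_on UNIV (gradient f)"
  shows "f y \<le> f x + gradient f x \<bullet> (y - x) + L / 2 * (norm (y - x))\<^sup>2"
proof -
  define d where "d = y - x"
  define \<phi> where "\<phi> t = f (x + t *\<^sub>R d) - t * (gradient f x \<bullet> d) - L / 2 * t\<^sup>2 * (norm d)\<^sup>2" for t
  have "\<phi> 1 \<le> \<phi> 0"
  proof (rule DERIV_nonpos_imp_nonincreasing[of 0 1 \<phi>])
    fix t :: real assume t: "0 \<le> t" "t \<le> 1"
    have "(f has_derivative (\<lambda>v. v \<bullet> gradient f (x + t *\<^sub>R d))) (at (x + t *\<^sub>R d))"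
      using GDERIV_gradient[OF diff] unfolding gderiv_def .
    moreover have "((\<lambda>t. x + t *\<^sub>R d) has_derivative (\<lambda>s. s *\<^sub>R d)) (at t)"
      by (auto intro!: derivative_eq_intros)
    ultimately have "((\<lambda>t. f (x + t *\<^sub>R d)) has_derivative (\<lambda>s. (s *\<^sub>R d) \<bullet> gradient f (x + t *\<^sub>R d))) (at t)"
      by (rule has_derivative_compose[rotated])
    then have "((\<lambda>t. f (x + t *\<^sub>R d)) has_real_derivative (gradient f (x + t *\<^sub>R d) \<bullet> d)) (at t)"
      unfolding has_field_derivative_def by (rule has_derivative_eq_rhs) (auto simp: inner_commute)
    then have "(\<phi> has_real_derivative (gradient f (x + t *\<^sub>R d) \<bullet> d - gradient f x \<bullet> d - L * t * (norm d)\<^sup>2)) (at t)"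
      unfolding \<phi>_def by (auto intro!: derivative_eq_intros)
    moreover have "(gradient f (x + t *\<^sub>R d) - gradient f x) \<bullet> d \<le> L * t * (norm d)\<^sup>2"
    proof -
      have "(gradient f (x + t *\<^sub>R d) - gradient f x) \<bullet> d \<le> norm (gradient f (x + t *\<^sub>R d) - gradient f x) * norm d"
        by (rule norm_cauchy_schwarz)
      also have "\<dots> \<le> (L * (t * norm d)) * norm d"
        using lipschitz_onD[OF lip, of "x + t *\<^sub>R d" x] t by (intro mult_right_mono) (simp_all add: dist_norm)
      finally show ?thesis by (simp add: power2_eq_square mult.assoc)
    qed
    ultimately show "\<exists>D. (\<phi> has_real_derivative D) (at t) \<and> D \<le> 0"
      by (auto simp: inner_diff_left)
  qed simp
  then show ?thesis unfolding \<phi>_def d_def by simp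
qed

text \<open>For surjective \<open>A\<close> the adjoint is injective, hence so is \<open>A \<circ> adjoint A\<close>, which is then bijective by
  equality of dimensions.\<close>

lemma
  fixes A :: "'a::euclidean_space \<Rightarrow> 'b::euclidean_space"
  assumes "linear A" "surj A"
  shows right_pinv_right_inverse: "A (right_pinv A y) = y"
    and linear_right_pinv: "linear (right_pinv A)"
proof -
  have lin: "linear (A \<circ> adjoint A)" using assms(1) adjoint_linear linear_compose by blast
  have "y = 0" if "(A \<circ> adjoint A) y = 0" for y
  proof -
    have "norm (adjoint A y) = 0"
      using that adjoint_works[OF assms(1), of "adjoint A y" y] by simp
    then have "A z \<bullet> y = 0" for z using adjoint_works[OF assms(1), of z y] by simp
    then show "y = 0" using assms(2) by (metis inner_eq_zero_iff surjD)
  qed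
  then have inj: "inj (A \<circ> adjoint A)" using lin by (simp add: linear_injective_0)
  then have surj: "surj (A \<circ> adjoint A)" using lin linear_injective_imp_surjective by blast
  show "A (right_pinv A y) = y"
    using surj_f_inv_f[OF surj, of y] unfolding right_pinv_def by simp
  have "linear (inv (A \<circ> adjoint A))"
    using lin inj by (rule inj_linear_imp_inv_linear)
  then show "linear (right_pinv A)"
    using linear_compose[OF _ adjoint_linear[OF assms(1)]] unfolding right_pinv_def[abs_def] by (simp add: o_def)
qed

context
  fixes f :: "'a::euclidean_space \<Rightarrow> real" and h :: "'b::euclidean_space \<Rightarrow> real" and A :: "'a \<Rightarrow> 'b"
    and lf lh \<rho> \<mu> :: real
  assumes f: "\<And>y. f differentiable (at y)" "lf-lipschitz_on UNIV (gradient f)"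
    and h: "lh-lipschitz_on UNIV h" "weakly_convex \<rho> h"
    and A: "linear A"
    and \<mu>: "\<mu> > 0" "\<mu> * \<rho> < 1"
begin

lemma gradient_smoothed:
  "gradient (smoothed f h A \<mu>) x = gradient f x + (1 / \<mu>) *\<^sub>R adjoint A (A x - prox \<mu> h (A x))"
proof (rule gradient_eqI)
  let ?r = "A x - prox \<mu> h (A x)"
  have "(moreau_env \<mu> h has_derivative (\<lambda>v. v \<bullet> ((1 / \<mu>) *\<^sub>R ?r))) (at (A x))"
    using GDERIV_moreau_env[OF h(1) \<mu>(1) h(2) \<mu>(2)] unfolding gderiv_def .
  then have "((\<lambda>x. moreau_env \<mu> h (A x)) has_derivative (\<lambda>v. A v \<bullet> ((1 / \<mu>) *\<^sub>R ?r))) (at x)"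
    by (rule has_derivative_compose[OF bounded_linear_imp_has_derivative[OF linear_conv_bounded_linear[THEN iffD1, OF A]]])
  then have "GDERIV (\<lambda>x. moreau_env \<mu> h (A x)) x :> (1 / \<mu>) *\<^sub>R adjoint A ?r"
    unfolding gderiv_def by (simp add: adjoint_works[OF A])
  from GDERIV_add[OF GDERIV_gradient[OF f(1)] this]
  show "GDERIV (smoothed f h A \<mu>) x :> gradient f x + (1 / \<mu>) *\<^sub>R adjoint A ?r"
    unfolding smoothed_def[abs_def] .
qed

lemma smoothed_upper_quadratic:
  "smoothed f h A \<mu> y \<le> smoothed f h A \<mu> x + gradient (smoothed f h A \<mu>) x \<bullet> (y - x)
    + (lf + (onorm A)\<^sup>2 / \<mu>) / 2 * (norm (y - x))\<^sup>2"
proof -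
  have "moreau_env \<mu> h (A y) \<le> moreau_env \<mu> h (A x) + (1 / \<mu>) * ((A x - prox \<mu> h (A x)) \<bullet> (A y - A x))
      + 1 / (2 * \<mu>) * (norm (A y - A x))\<^sup>2"
    by (rule moreau_env_upper_quadratic[OF h(1) \<mu>(1)])
  also have "A y - A x = A (y - x)" using A by (simp add: linear_diff)
  also have "1 / (2 * \<mu>) * (norm (A (y - x)))\<^sup>2 \<le> 1 / (2 * \<mu>) * (onorm A * norm (y - x))\<^sup>2"
    using \<mu>(1) onorm[OF linear_conv_bounded_linear[THEN iffD1, OF A]]
    by (intro mult_left_mono power_mono) auto
  also have "(A x - prox \<mu> h (A x)) \<bullet> A (y - x) = adjoint A (A x - prox \<mu> h (A x)) \<bullet> (y - x)"
    using adjoint_works[OF A, of "y - x"] by (simp add: inner_commute)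
  finally have "moreau_env \<mu> h (A y) \<le> moreau_env \<mu> h (A x) + (1 / \<mu>) * (adjoint A (A x - prox \<mu> h (A x)) \<bullet> (y - x))
      + 1 / (2 * \<mu>) * (onorm A * norm (y - x))\<^sup>2" by simp
  moreover have "(lf + (onorm A)\<^sup>2 / \<mu>) / 2 * (norm (y - x))\<^sup>2
      = lf / 2 * (norm (y - x))\<^sup>2 + 1 / (2 * \<mu>) * (onorm A * norm (y - x))\<^sup>2"
    by (simp add: power_mult_distrib field_simps)
  ultimately show ?thesis
    using lipschitz_gradient_upper_quadratic[OF f, of y x]
    unfolding gradient_smoothed smoothed_def inner_add_left inner_scaleR_left by linarith
qed

lemma continuous_on_gradient_smoothed: "continuous_on S (gradient (smoothed f h A \<mu>))"
  unfolding gradient_smoothed[abs_def]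
proof (intro continuous_intros)
  have cA: "continuous_on S A" by (rule linear_continuous_on[OF linear_conv_bounded_linear[THEN iffD1, OF A]])
  show "continuous_on S (gradient f)"
    using lipschitz_on_continuous_on[OF f(2)] by (rule continuous_on_subset) simp
  show "continuous_on S (\<lambda>x. adjoint A (A x - prox \<mu> h (A x)))"
    by (intro linear_continuous_on_compose[OF _ adjoint_linear[OF A]] continuous_intros cA
        continuous_on_compose2[OF continuous_on_prox[OF h(1) \<mu>(1) h(2) \<mu>(2), of UNIV] cA]) auto
qed

lemma continuous_on_smoothed: "continuous_on S (smoothed f h A \<mu>)"
  unfolding smoothed_def[abs_def]
proof (intro continuous_intros)
  have cA: "continuous_on S A" by (rule linear_continuous_on[OF linear_conv_bounded_linear[THEN iffD1, OF A]])
  show "continuous_on S f"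
    using f(1) by (intro differentiable_imp_continuous_on) (auto simp: differentiable_on_def intro: differentiable_at_withinI)
  have "isCont (moreau_env \<mu> h) y" for y
    using GDERIV_moreau_env[OF h(1) \<mu>(1) h(2) \<mu>(2)] has_derivative_continuous unfolding gderiv_def by blast
  then have "continuous_on UNIV (moreau_env \<mu> h)" by (simp add: continuous_on_eq_continuous_at)
  then show "continuous_on S (\<lambda>x. moreau_env \<mu> h (A x))" by (rule continuous_on_compose2[OF _ cA]) simp
qed

lemma stoch_rgrad_eq:
  "stoch_rgrad M h A \<mu> x g = orth_proj (tangent_space M x) (gradient (smoothed f h A \<mu>) x + (g - gradient f x))"
  unfolding stoch_rgrad_def gradient_smoothed by (simp add: add.commute add.left_commute)

text \<open>One step of the method for a given sample gradient \<open>g\<close>. The retraction is replaced by the identity at the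
  cost \<open>G * \<beta>\<close> in the linear term and of the factor \<open>\<alpha>\<^sup>2\<close> in the quadratic one, which is what \<open>Lip\<close>
  collects. Since \<open>v\<close> is tangent, its inner product with the projected noise is the one with the noise itself, a
  term that vanishes in expectation.\<close>

lemma smoothed_retraction_step:
  fixes \<alpha> \<beta> G \<gamma> Lip :: real
  assumes T: "subspace (tangent_space M x)" and "G \<ge> 0" "norm (gradient (smoothed f h A \<mu>) x) \<le> G"
    and R: "\<And>u. u \<in> tangent_space M x \<Longrightarrow> norm (R u - x) \<le> \<alpha> * norm u"
      "\<And>u. u \<in> tangent_space M x \<Longrightarrow> norm (R u - x - u) \<le> \<beta> * (norm u)\<^sup>2"
    and Lip: "Lip = \<alpha>\<^sup>2 * lf + \<alpha>\<^sup>2 * (onorm A)\<^sup>2 * inverse \<mu> + 2 * G * \<beta>" "Lip \<ge> 0"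
  defines "v \<equiv> stoch_rgrad M h A \<mu> x (gradient f x)"
  shows "smoothed f h A \<mu> (R (- \<gamma> *\<^sub>R stoch_rgrad M h A \<mu> x g))
    \<le> smoothed f h A \<mu> x - (\<gamma> - Lip * \<gamma>\<^sup>2 / 2) * (norm v)\<^sup>2 - (\<gamma> - Lip * \<gamma>\<^sup>2) * (v \<bullet> (g - gradient f x))
      + Lip * \<gamma>\<^sup>2 / 2 * (norm (g - gradient f x))\<^sup>2"
proof -
  let ?T = "tangent_space M x" and ?F = "smoothed f h A \<mu>" and ?n = "g - gradient f x"
  define p where "p = orth_proj ?T ?n"
  define u where "u = - \<gamma> *\<^sub>R (v + p)"
  have v_def': "v = orth_proj ?T (gradient ?F x)" unfolding v_def stoch_rgrad_eq by simp
  have s: "stoch_rgrad M h A \<mu> x g = v + p"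
    unfolding stoch_rgrad_eq v_def' p_def by (rule orth_proj_add[OF T])
  have vT: "v \<in> ?T" and pT: "p \<in> ?T" unfolding v_def' p_def by (rule orth_proj(1)[OF T])+
  then have uT: "u \<in> ?T" unfolding u_def using T by (intro subspace_scale subspace_add)
  have vp: "v \<bullet> p = v \<bullet> ?n"
    using orth_proj(2)[OF T vT, of ?n] unfolding p_def by (simp add: inner_commute)
  have gu: "gradient ?F x \<bullet> u = v \<bullet> u"
    using orth_proj(2)[OF T uT] unfolding v_def' by simp
  have L: "lf + (onorm A)\<^sup>2 / \<mu> \<ge> 0" using lipschitz_on_nonneg[OF f(2)] \<mu>(1) by simp
  have "gradient ?F x \<bullet> (R u - x) = v \<bullet> u + gradient ?F x \<bullet> (R u - x - u)"
    unfolding gu[symmetric] by (simp add: inner_diff_right)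
  also have "gradient ?F x \<bullet> (R u - x - u) \<le> norm (gradient ?F x) * norm (R u - x - u)"
    by (rule norm_cauchy_schwarz)
  also have "\<dots> \<le> G * (\<beta> * (norm u)\<^sup>2)"
    using assms(2,3) R(2)[OF uT] by (intro mult_mono) auto
  finally have lin: "gradient ?F x \<bullet> (R u - x) \<le> v \<bullet> u + G * (\<beta> * (norm u)\<^sup>2)" by simp
  have quad: "(lf + (onorm A)\<^sup>2 / \<mu>) / 2 * (norm (R u - x))\<^sup>2 \<le> (lf + (onorm A)\<^sup>2 / \<mu>) / 2 * (\<alpha> * norm u)\<^sup>2"
    using L R(1)[OF uT] by (intro mult_left_mono power_mono) auto
  have "?F (R u) \<le> ?F x + v \<bullet> u + (G * (\<beta> * (norm u)\<^sup>2) + (lf + (onorm A)\<^sup>2 / \<mu>) / 2 * (\<alpha> * norm u)\<^sup>2)"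
    using smoothed_upper_quadratic[of "R u" x] lin quad by linarith
  also have "G * (\<beta> * (norm u)\<^sup>2) + (lf + (onorm A)\<^sup>2 / \<mu>) / 2 * (\<alpha> * norm u)\<^sup>2 = Lip / 2 * (norm u)\<^sup>2"
    unfolding Lip(1) using \<mu>(1) by (simp add: field_simps power_mult_distrib)
  also have "(norm u)\<^sup>2 = \<gamma>\<^sup>2 * ((norm v)\<^sup>2 + 2 * (v \<bullet> ?n) + (norm p)\<^sup>2)"
    unfolding u_def vp[symmetric] power2_norm_eq_inner
    by (simp add: inner_add_left inner_add_right inner_commute power2_eq_square algebra_simps)
  also have "v \<bullet> u = - \<gamma> * ((norm v)\<^sup>2 + v \<bullet> ?n)"
    unfolding u_def vp[symmetric] power2_norm_eq_inner by (simp add: inner_add_right)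
  also have "Lip / 2 * (\<gamma>\<^sup>2 * ((norm v)\<^sup>2 + 2 * (v \<bullet> ?n) + (norm p)\<^sup>2))
      \<le> Lip / 2 * (\<gamma>\<^sup>2 * ((norm v)\<^sup>2 + 2 * (v \<bullet> ?n) + (norm ?n)\<^sup>2))"
    using norm_orth_proj_le[OF T, of ?n] Lip(2) unfolding p_def
    by (intro mult_left_mono add_left_mono power_mono) auto
  finally show ?thesis unfolding s u_def[symmetric] by (simp add: algebra_simps)
qed

context
  assumes surjA: "surj A"
begin

text \<open>The point \<open>xhat\<close> is the correction of \<open>x\<close> for which the image under \<open>A\<close> is the proximal point, where
  a subgradient of \<open>h\<close> is known.\<close>

lemma A_prox_point: "A (prox_point A h \<mu> x) = prox \<mu> h (A x)"
  unfolding prox_point_def using A right_pinv_right_inverse[OF A surjA] by (simp add: linear_diff)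

lemma norm_prox_point_diff_le:
  assumes "\<And>y. norm (right_pinv A y) \<le> K * norm y" "K \<ge> 0"
  shows "norm (x - prox_point A h \<mu> x) \<le> 2 * K * lh * \<mu>"
proof -
  have "norm (x - prox_point A h \<mu> x) \<le> K * norm (A x - prox \<mu> h (A x))"
    unfolding prox_point_def using assms(1) by simp
  also have "\<dots> \<le> K * (2 * \<mu> * lh)"
    using assms(2) norm_prox_diff_le[OF h(1) \<mu>(1)] by (intro mult_left_mono)
  finally show ?thesis by (simp add: algebra_simps)
qed

lemma stationarity_gap_le:
  assumes T: "subspace (tangent_space M x)"
  shows "stationarity_gap M f h A x (prox_point A h \<mu> x) (A (prox_point A h \<mu> x))
    \<le> norm (stoch_rgrad M h A \<mu> x (gradient f x)) + lf * norm (x - prox_point A h \<mu> x)"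
proof -
  let ?xh = "prox_point A h \<mu> x" and ?P = "orth_proj (tangent_space M x)"
  let ?\<zeta> = "(1 / \<mu>) *\<^sub>R (A x - prox \<mu> h (A x))"
  have "?\<zeta> \<in> limiting_subdiff h (A ?xh)"
    unfolding A_prox_point using prox_residual_subgradient[OF h(1) \<mu>(1)] regular_subdiff_subset_limiting by blast
  then have "stationarity_gap M f h A x ?xh (A ?xh) \<le> dist 0 (?P (gradient f ?xh + adjoint A ?\<zeta>))"
    unfolding stationarity_gap_def by (intro infdist_le) blast
  also have "gradient f ?xh + adjoint A ?\<zeta>
      = (gradient f x + (1 / \<mu>) *\<^sub>R adjoint A (A x - prox \<mu> h (A x))) + (gradient f ?xh - gradient f x)"
    using adjoint_linear[OF A] by (simp add: linear_cmul)
  also have "?P \<dots> = stoch_rgrad M h A \<mu> x (gradient f x) + ?P (gradient f ?xh - gradient f x)"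
    unfolding orth_proj_add[OF T] stoch_rgrad_def ..
  also have "dist 0 \<dots> \<le> norm (stoch_rgrad M h A \<mu> x (gradient f x)) + norm (?P (gradient f ?xh - gradient f x))"
    by (simp add: norm_triangle_ineq)
  also have "norm (?P (gradient f ?xh - gradient f x)) \<le> lf * norm (x - ?xh)"
    using norm_orth_proj_le[OF T, of "gradient f ?xh - gradient f x"] lipschitz_onD[OF f(2), of ?xh x]
    by (simp add: dist_norm norm_minus_commute)
  finally show ?thesis by simp
qed

text \<open>The sublevel sets are closed in \<open>M\<close>: near-optimal subgradients along a convergent sequence of points are
  bounded, so they accumulate at a subgradient over the limit point, and the projection onto the tangent space
  is continuous along the sequence.\<close>

lemma borel_measurable_stationarity_gap:
  assumes M: "closed M" "embedded_submanifold d M"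
  shows "(\<lambda>x. stationarity_gap M f h A x (prox_point A h \<mu> x) (A (prox_point A h \<mu> x)))
    \<in> borel_measurable (restrict_space borel M)"
proof -
  let ?xh = "prox_point A h \<mu>" and ?P = "\<lambda>x. orth_proj (tangent_space M x)"
  let ?S = "\<lambda>x. {?P x (gradient f (?xh x) + adjoint A \<zeta>) | \<zeta>. \<zeta> \<in> limiting_subdiff h (A (?xh x))}"
  define q where "q x = stationarity_gap M f h A x (?xh x) (A (?xh x))" for x
  have cA: "continuous_on UNIV A" by (rule linear_continuous_on[OF linear_conv_bounded_linear[THEN iffD1, OF A]])
  have cp: "continuous_on UNIV (\<lambda>x. prox \<mu> h (A x))"
    by (rule continuous_on_compose2[OF continuous_on_prox[OF h(1) \<mu>(1) h(2) \<mu>(2), of UNIV] cA]) simp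
  have "continuous_on UNIV ?xh"
    unfolding prox_point_def[abs_def]
    by (intro continuous_intros linear_continuous_on_compose[OF _ linear_right_pinv[OF A surjA]] cA cp)
  then have xh: "isCont ?xh x" for x by (simp add: continuous_on_eq_continuous_at)
  have p: "isCont (\<lambda>x. prox \<mu> h (A x)) x" for x using cp by (simp add: continuous_on_eq_continuous_at)
  have gf: "isCont (gradient f) x" for x
    using lipschitz_on_continuous_on[OF f(2)] by (simp add: continuous_on_eq_continuous_at)
  have ch: "isCont h z" for z
    using lipschitz_on_continuous_on[OF h(1)] by (simp add: continuous_on_eq_continuous_at)
  have "closed {x \<in> M. q x \<le> a}" for a
    unfolding closed_sequential_limits
  proof clarify
    fix xs x assume xs: "\<forall>n. xs n \<in> {x \<in> M. q x \<le> a}" and lim: "xs \<longlonglongrightarrow> x"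
    have xsM: "\<And>n. xs n \<in> M" using xs by blast
    have xM: "x \<in> M" using closed_sequentially[OF M(1)] xsM lim by blast
    have "\<exists>\<zeta>. \<zeta> \<in> limiting_subdiff h (A (?xh (xs n))) \<and>
        norm (?P (xs n) (gradient f (?xh (xs n)) + adjoint A \<zeta>)) < a + 1 / real (Suc n)" for n
    proof -
      have ne: "?S (xs n) \<noteq> {}"
        using prox_residual_subgradient[OF h(1) \<mu>(1)] regular_subdiff_subset_limiting
        unfolding A_prox_point by blast
      have "q (xs n) \<le> a" using xs by blast
      also have "a < a + 1 / real (Suc n)" by simp
      finally have "infdist 0 (?S (xs n)) < a + 1 / real (Suc n)"
        unfolding q_def stationarity_gap_def .
      then obtain s where "s \<in> ?S (xs n)" "dist 0 s < a + 1 / real (Suc n)"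
        unfolding infdist_notempty[OF ne] by (subst (asm) cINF_less_iff[OF ne]) (auto intro: bdd_belowI2[of _ 0])
      then show ?thesis by auto
    qed
    then obtain \<zeta> where \<zeta>: "\<And>n. \<zeta> n \<in> limiting_subdiff h (A (?xh (xs n)))"
      "\<And>n. norm (?P (xs n) (gradient f (?xh (xs n)) + adjoint A (\<zeta> n))) < a + 1 / real (Suc n)" by metis
    have "bounded (range \<zeta>)"
      unfolding bounded_iff using norm_limiting_subgradient_le[OF h(1) \<zeta>(1)] by blast
    then obtain z r where r: "strict_mono r" "(\<zeta> \<circ> r) \<longlonglongrightarrow> z"
      using bounded_imp_convergent_subsequence by blast
    have \<zeta>r: "(\<lambda>n. \<zeta> (r n)) \<longlonglongrightarrow> z" using r(2) by (simp add: o_def)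
    have xr: "(\<lambda>n. xs (r n)) \<longlonglongrightarrow> x" using LIMSEQ_subseq_LIMSEQ[OF lim r(1)] by (simp add: o_def)
    have "z \<in> limiting_subdiff h (prox \<mu> h (A x))"
    proof (rule limiting_subdiff_closed_graph[OF ch isCont_tendsto_compose[OF p xr] \<zeta>r])
      show "\<zeta> (r n) \<in> limiting_subdiff h (prox \<mu> h (A (xs (r n))))" for n
        using \<zeta>(1)[of "r n"] unfolding A_prox_point .
    qed
    then have z: "z \<in> limiting_subdiff h (A (?xh x))" unfolding A_prox_point .
    have "(\<lambda>n. gradient f (?xh (xs (r n))) + adjoint A (\<zeta> (r n))) \<longlonglongrightarrow> gradient f (?xh x) + adjoint A z"
      by (intro tendsto_add isCont_tendsto_compose[OF gf] isCont_tendsto_compose[OF xh] xr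
          bounded_linear.tendsto[OF linear_conv_bounded_linear[THEN iffD1, OF adjoint_linear[OF A]] \<zeta>r])
    from orth_proj_tangent_space_tendsto[OF M(2) xM xsM xr this]
    have "(\<lambda>n. norm (?P (xs (r n)) (gradient f (?xh (xs (r n))) + adjoint A (\<zeta> (r n)))))
        \<longlonglongrightarrow> norm (?P x (gradient f (?xh x) + adjoint A z))" by (rule tendsto_norm)
    moreover have "(\<lambda>n. a + 1 / real (Suc (r n))) \<longlonglongrightarrow> a + 0"
      using LIMSEQ_subseq_LIMSEQ[OF LIMSEQ_inverse_real_of_nat r(1)]
      by (intro tendsto_add tendsto_const) (simp add: o_def inverse_eq_divide)
    ultimately have "norm (?P x (gradient f (?xh x) + adjoint A z)) \<le> a + 0"
      by (rule LIMSEQ_le) (use \<zeta>(2) less_imp_le in blast)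
    moreover have "q x \<le> dist 0 (?P x (gradient f (?xh x) + adjoint A z))"
      unfolding q_def stationarity_gap_def using z by (intro infdist_le) blast
    ultimately show "x \<in> M \<and> q x \<le> a" using xM by simp
  qed
  then have "{x \<in> M. q x \<le> a} \<in> sets (restrict_space borel M)" for a
    using M(1) by (subst sets_restrict_space_iff) auto
  then have "q \<in> borel_measurable (restrict_space borel M)"
    by (intro borel_measurableI_le) (simp add: space_restrict_space)
  then show ?thesis unfolding q_def[abs_def] .
qed

end

end

section \<open>Independence and expectations\<close>

text \<open>The preimages under one random variable are stable under intersection, so independence passes from them to
  the sigma-algebras that they generate.\<close>

lemma (in prob_space) indep_varI_indep_set:
  assumes "random_variable S X" "random_variable T Y"
    and "indep_set {X -` A \<inter> space M | A. A \<in> sets S} {Y -` B \<inter> space M | B. B \<in> sets T}"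
  shows "indep_var S X T Y"
proof -
  have stable: "Int_stable {Z -` A \<inter> space M | A. A \<in> sets U}" for Z :: "'a \<Rightarrow> 'x" and U
  proof (rule Int_stableI)
    fix a b assume "a \<in> {Z -` A \<inter> space M | A. A \<in> sets U}" "b \<in> {Z -` A \<inter> space M | A. A \<in> sets U}"
    then obtain A B where "A \<in> sets U" "B \<in> sets U" "a = Z -` A \<inter> space M" "b = Z -` B \<inter> space M" by blast
    then show "a \<inter> b \<in> {Z -` A \<inter> space M | A. A \<in> sets U}"
      by (intro CollectI exI[of _ "A \<inter> B"]) auto
  qed
  show ?thesis
    unfolding indep_var_eq using assms by (intro conjI indep_set_sigma_sets stable)
qed

text \<open>Independence of \<open>X\<close> and \<open>Y\<close> is assumed through preimages because the two variables take values in
  different types; it is used for real functions of them.\<close>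

lemma (in prob_space) expectation_indep_index:
  fixes q :: "'s \<Rightarrow> real" and r :: "'t \<Rightarrow> nat"
  assumes X: "random_variable S X" and Y: "random_variable T Y"
    and ind: "indep_set {X -` A \<inter> space M | A. A \<in> sets S} {Y -` B \<inter> space M | B. B \<in> sets T}"
    and q: "q \<in> borel_measurable S" and int: "integrable M (\<lambda>w. q (X w))"
    and r: "r \<in> T \<rightarrow>\<^sub>M count_space UNIV"
  shows "integrable M (\<lambda>w. indicator {k} (r (Y w)) * q (X w))"
    and "expectation (\<lambda>w. indicator {k} (r (Y w)) * q (X w)) = prob {w \<in> space M. r (Y w) = k} * expectation (\<lambda>w. q (X w))"
proof -
  let ?i = "\<lambda>y. indicator {k} (r y) :: real"
  have i: "?i \<in> borel_measurable T" by (rule measurable_compose[OF r]) simp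
  have iv: "indep_var borel (\<lambda>w. q (X w)) borel (\<lambda>w. ?i (Y w))"
  proof (rule indep_varI_indep_set)
    have sub: "{(\<lambda>w. \<phi> (Z w)) -` A \<inter> space M | A. A \<in> sets borel} \<subseteq> {Z -` B \<inter> space M | B. B \<in> sets U}"
      if "\<phi> \<in> borel_measurable U" "random_variable U Z" for \<phi> :: "'z \<Rightarrow> real" and Z U
    proof clarify
      fix A :: "real set" assume "A \<in> sets borel"
      then have "\<phi> -` A \<inter> space U \<in> sets U" using that(1) by (rule measurable_sets[rotated])
      moreover have "(\<lambda>w. \<phi> (Z w)) -` A \<inter> space M = Z -` (\<phi> -` A \<inter> space U) \<inter> space M"
        using measurable_space[OF that(2)] by auto
      ultimately show "\<exists>B. (\<lambda>w. \<phi> (Z w)) -` A \<inter> space M = Z -` B \<inter> space M \<and> B \<in> sets U" by blast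
    qed
    from ind sub[OF q X] sub[OF i Y]
    show "indep_set {(\<lambda>w. q (X w)) -` A \<inter> space M | A. A \<in> sets borel} {(\<lambda>w. ?i (Y w)) -` B \<inter> space M | B. B \<in> sets borel}"
      unfolding indep_sets2_eq by (meson subset_iff subset_trans)
  qed (use measurable_compose[OF X q] measurable_compose[OF Y i] in simp_all)
  have ii: "integrable M (\<lambda>w. ?i (Y w))"
    using measurable_compose[OF Y i] by (intro integrable_const_bound[where B=1]) (auto simp: indicator_def)
  show "integrable M (\<lambda>w. indicator {k} (r (Y w)) * q (X w))"
    using indep_var_integrable[OF iv int ii] by (simp add: mult.commute)
  have set: "{w \<in> space M. r (Y w) = k} \<in> events"
    using measurable_compose[OF Y r] by measurable
  have "expectation (\<lambda>w. ?i (Y w)) = expectation (indicator {w \<in> space M. r (Y w) = k})"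
    by (rule Bochner_Integration.integral_cong) (auto simp: indicator_def)
  also have "\<dots> = prob {w \<in> space M. r (Y w) = k}" using set by simp
  finally show "expectation (\<lambda>w. indicator {k} (r (Y w)) * q (X w)) = prob {w \<in> space M. r (Y w) = k} * expectation (\<lambda>w. q (X w))"
    using indep_var_lebesgue_integral[OF iv int ii] by (simp add: mult.commute)
qed

text \<open>This moves independence of two blocks of samples, which have the same type, to derived variables of
  different types, where it takes the form of a product law.\<close>

lemma (in prob_space) joint_law_compose:
  assumes ind: "indep_var S X T Y" and f: "f \<in> S \<rightarrow>\<^sub>M U" and g: "g \<in> T \<rightarrow>\<^sub>M W"
  shows "distr M (U \<Otimes>\<^sub>M W) (\<lambda>w. (f (X w), g (Y w))) = distr M U (\<lambda>w. f (X w)) \<Otimes>\<^sub>M distr M W (\<lambda>w. g (Y w))"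
proof -
  have X: "random_variable S X" and Y: "random_variable T Y" using ind unfolding indep_var_eq by blast+
  have dX: "distr M U (\<lambda>w. f (X w)) = distr (distr M S X) U f"
    and dY: "distr M W (\<lambda>w. g (Y w)) = distr (distr M T Y) W g"
    using X Y f g by (simp_all add: distr_distr o_def)
  have "prob_space (distr (distr M T Y) W g)"
    unfolding dY[symmetric] using measurable_compose[OF Y g] by (rule prob_space_distr)
  then have "distr M U (\<lambda>w. f (X w)) \<Otimes>\<^sub>M distr M W (\<lambda>w. g (Y w))
      = distr (distr M S X \<Otimes>\<^sub>M distr M T Y) (U \<Otimes>\<^sub>M W) (\<lambda>(x, y). (f x, g y))"
    unfolding dX dY using f g by (intro pair_measure_distr) (auto simp: prob_space_imp_sigma_finite)
  also have "\<dots> = distr M (U \<Otimes>\<^sub>M W) (\<lambda>w. (f (X w), g (Y w)))"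
    unfolding indep_var_distribution_eq[THEN iffD1, OF ind, THEN conjunct2, THEN conjunct2]
    using X Y f g by (subst distr_distr) (auto simp: o_def)
  finally show ?thesis ..
qed

text \<open>Fubini over the product law of \<open>X\<close> and \<open>\<xi>\<close>: for each fixed value of \<open>X\<close> the inner integral over the
  sample is bounded by \<open>V\<close>, respectively vanishes. The mixed term is integrable because it is dominated by a multiple of one plus the
  square.\<close>

lemma (in prob_space) centred_noise_expectations:
  fixes n :: "'x \<Rightarrow> 's \<Rightarrow> 'c::euclidean_space" and v :: "'x \<Rightarrow> 'c"
  assumes X: "random_variable N X" and \<xi>: "random_variable D \<xi>" and law: "distr M D \<xi> = D"
    and ind: "distr M (N \<Otimes>\<^sub>M D) (\<lambda>w. (X w, \<xi> w)) = distr M N X \<Otimes>\<^sub>M distr M D \<xi>"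
    and n: "(\<lambda>(y, s). n y s) \<in> borel_measurable (N \<Otimes>\<^sub>M D)"
    and n_int: "\<And>y. y \<in> space N \<Longrightarrow> integrable D (n y)"
      "\<And>y. y \<in> space N \<Longrightarrow> (\<integral>s. n y s \<partial>D) = 0"
    and n_var: "\<And>y. y \<in> space N \<Longrightarrow> integrable D (\<lambda>s. (norm (n y s))\<^sup>2)"
      "\<And>y. y \<in> space N \<Longrightarrow> (\<integral>s. (norm (n y s))\<^sup>2 \<partial>D) \<le> V"
    and v: "v \<in> borel_measurable N" "\<And>y. y \<in> space N \<Longrightarrow> norm (v y) \<le> B"
  shows "integrable M (\<lambda>w. (norm (n (X w) (\<xi> w)))\<^sup>2)"
    and "expectation (\<lambda>w. (norm (n (X w) (\<xi> w)))\<^sup>2) \<le> V"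
    and "integrable M (\<lambda>w. v (X w) \<bullet> n (X w) (\<xi> w))"
    and "expectation (\<lambda>w. v (X w) \<bullet> n (X w) (\<xi> w)) = 0"
proof -
  define Q where "Q = distr M N X"
  interpret Q: prob_space Q unfolding Q_def using X by (rule prob_space_distr)
  interpret D: prob_space D using prob_space_distr[OF \<xi>] unfolding law .
  interpret QD: pair_sigma_finite Q D ..
  have sQ: "sets Q = sets N" "space Q = space N" unfolding Q_def by simp_all
  have sp: "sets (Q \<Otimes>\<^sub>M D) = sets (N \<Otimes>\<^sub>M D)" using sQ by (intro sets_pair_measure_cong) simp_all
  have joint: "distr M (N \<Otimes>\<^sub>M D) (\<lambda>w. (X w, \<xi> w)) = Q \<Otimes>\<^sub>M D"
    using ind unfolding Q_def law .
  have XY: "(\<lambda>w. (X w, \<xi> w)) \<in> M \<rightarrow>\<^sub>M N \<Otimes>\<^sub>M D" using X \<xi> by measurable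
  have nQ: "(\<lambda>(y, s). n y s) \<in> borel_measurable (Q \<Otimes>\<^sub>M D)" using n sp measurable_cong_sets by blast
  have vQ: "v \<in> borel_measurable Q" using v(1) sQ measurable_cong_sets by blast
  have sqQ: "(\<lambda>p. (norm (case p of (y, s) \<Rightarrow> n y s))\<^sup>2) \<in> borel_measurable (Q \<Otimes>\<^sub>M D)" using nQ by measurable
  have ciQ: "(\<lambda>p. v (fst p) \<bullet> (case p of (y, s) \<Rightarrow> n y s)) \<in> borel_measurable (Q \<Otimes>\<^sub>M D)"
    using nQ vQ by measurable
  have V: "0 \<le> (\<integral>s. (norm (n y s))\<^sup>2 \<partial>D)" for y by simp
  have meas: "(\<lambda>y. \<integral>s. (norm (n y s))\<^sup>2 \<partial>D) \<in> borel_measurable Q"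
    using D.borel_measurable_lebesgue_integral[of "\<lambda>y s. (norm (n y s))\<^sup>2" Q] sqQ by (simp add: case_prod_beta')
  have intV: "integrable Q (\<lambda>y. \<integral>s. (norm (n y s))\<^sup>2 \<partial>D)"
    using meas V n_var(2) by (intro Q.integrable_const_bound[where B=V]) (auto simp: sQ intro!: AE_I2)
  have sqI: "integrable (Q \<Otimes>\<^sub>M D) (\<lambda>p. (norm (case p of (y, s) \<Rightarrow> n y s))\<^sup>2)"
    using intV n_var(1) by (intro QD.Fubini_integrable sqQ) (auto simp: sQ intro!: AE_I2)
  have sqE: "integral\<^sup>L (Q \<Otimes>\<^sub>M D) (\<lambda>p. (norm (case p of (y, s) \<Rightarrow> n y s))\<^sup>2) = (\<integral>y. (\<integral>s. (norm (n y s))\<^sup>2 \<partial>D) \<partial>Q)"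
    using QD.integral_fst'[OF sqI] by simp
  also have "\<dots> \<le> (\<integral>y. V \<partial>Q)"
    using intV n_var(2) by (intro integral_mono) (auto simp: sQ)
  also have "\<dots> = V" using Q.prob_space by simp
  finally have sqV: "integral\<^sup>L (Q \<Otimes>\<^sub>M D) (\<lambda>p. (norm (case p of (y, s) \<Rightarrow> n y s))\<^sup>2) \<le> V" .
  have ciI: "integrable (Q \<Otimes>\<^sub>M D) (\<lambda>p. v (fst p) \<bullet> (case p of (y, s) \<Rightarrow> n y s))"
  proof (rule Bochner_Integration.integrable_bound[OF _ ciQ])
    interpret PQD: pair_prob_space Q D ..
    show "integrable (Q \<Otimes>\<^sub>M D) (\<lambda>p. \<bar>B\<bar> * (1 + (norm (case p of (y, s) \<Rightarrow> n y s))\<^sup>2))"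
      using sqI by (intro integrable_mult_right Bochner_Integration.integrable_add) auto
    show "AE p in Q \<Otimes>\<^sub>M D. norm (v (fst p) \<bullet> (case p of (y, s) \<Rightarrow> n y s))
        \<le> norm (\<bar>B\<bar> * (1 + (norm (case p of (y, s) \<Rightarrow> n y s))\<^sup>2))"
    proof (rule AE_I2)
      fix p assume p: "p \<in> space (Q \<Otimes>\<^sub>M D)"
      let ?n = "case p of (y, s) \<Rightarrow> n y s"
      have "norm (v (fst p)) \<le> \<bar>B\<bar>" using v(2)[of "fst p"] p by (auto simp: space_pair_measure sQ)
      have "\<bar>v (fst p) \<bullet> ?n\<bar> \<le> norm (v (fst p)) * norm ?n" by (rule Cauchy_Schwarz_ineq2)
      also have "\<dots> \<le> \<bar>B\<bar> * norm ?n"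
        using \<open>norm (v (fst p)) \<le> \<bar>B\<bar>\<close> by (rule mult_right_mono) simp
      also have "norm ?n \<le> 1 + (norm ?n)\<^sup>2"
      proof -
        have "2 * norm ?n \<le> 1 + (norm ?n)\<^sup>2"
          using zero_le_power2[of "norm ?n - 1"] by (simp add: power2_diff)
        then show ?thesis using norm_ge_zero[of ?n] by linarith
      qed
      finally have "\<bar>v (fst p) \<bullet> ?n\<bar> \<le> \<bar>B\<bar> * (1 + (norm ?n)\<^sup>2)" by (simp add: mult_left_mono)
      then show "norm (v (fst p) \<bullet> ?n) \<le> norm (\<bar>B\<bar> * (1 + (norm ?n)\<^sup>2))" by (simp add: abs_mult)
    qed
  qed
  have "integral\<^sup>L (Q \<Otimes>\<^sub>M D) (\<lambda>p. v (fst p) \<bullet> (case p of (y, s) \<Rightarrow> n y s)) = (\<integral>y. (\<integral>s. v y \<bullet> n y s \<partial>D) \<partial>Q)"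
    using QD.integral_fst'[OF ciI] by simp
  also have "\<dots> = (\<integral>y. 0 \<partial>Q)"
    using n_int by (intro Bochner_Integration.integral_cong) (auto simp: sQ)
  finally have ci0: "integral\<^sup>L (Q \<Otimes>\<^sub>M D) (\<lambda>p. v (fst p) \<bullet> (case p of (y, s) \<Rightarrow> n y s)) = 0" by simp
  have sqN: "(\<lambda>p. (norm (case p of (y, s) \<Rightarrow> n y s))\<^sup>2) \<in> borel_measurable (N \<Otimes>\<^sub>M D)"
    and ciN: "(\<lambda>p. v (fst p) \<bullet> (case p of (y, s) \<Rightarrow> n y s)) \<in> borel_measurable (N \<Otimes>\<^sub>M D)"
    using n v(1) by measurable
  show "integrable M (\<lambda>w. (norm (n (X w) (\<xi> w)))\<^sup>2)"
    using sqI integrable_distr_eq[OF XY sqN] unfolding joint by simp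
  show "expectation (\<lambda>w. (norm (n (X w) (\<xi> w)))\<^sup>2) \<le> V"
    using sqV integral_distr[OF XY sqN] unfolding joint by simp
  show "integrable M (\<lambda>w. v (X w) \<bullet> n (X w) (\<xi> w))"
    using ciI integrable_distr_eq[OF XY ciN] unfolding joint by simp
  show "expectation (\<lambda>w. v (X w) \<bullet> n (X w) (\<xi> w)) = 0"
    using ci0 integral_distr[OF XY ciN] unfolding joint by simp
qed

section \<open>Iterates driven by independent samples\<close>

text \<open>The iterates as deterministic functions of the whole sample sequence, so that measurability and independence
  can be read off from the coordinates used. The iteration starts at index \<open>1\<close>; the value at \<open>0\<close> is a dummy.\<close>

primrec iterate :: "(nat \<Rightarrow> 'a \<Rightarrow> 's \<Rightarrow> 'a) \<Rightarrow> 'a \<Rightarrow> nat \<Rightarrow> (nat \<Rightarrow> 's) \<Rightarrow> 'a" where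
  "iterate \<Phi> a 0 s = a"
| "iterate \<Phi> a (Suc k) s = (if k = 0 then a else \<Phi> k (iterate \<Phi> a k s) (s k))"

lemma measurable_iterate:
  assumes a: "a \<in> space N" and \<Phi>: "\<And>k. k \<ge> 1 \<Longrightarrow> (\<lambda>(y, s). \<Phi> k y s) \<in> N \<Otimes>\<^sub>M D \<rightarrow>\<^sub>M N"
    and "{1..<k} \<subseteq> I"
  shows "iterate \<Phi> a k \<in> PiM I (\<lambda>_. D) \<rightarrow>\<^sub>M N"
  using assms(3)
proof (induction k)
  case 0
  then show ?case using a by simp
next
  case (Suc k)
  show ?case
  proof (cases "k = 0")
    case True
    then show ?thesis using a by simp
  next
    case False
    then have "k \<in> I" "{1..<k} \<subseteq> I" using Suc.prems by auto
    then have "(\<lambda>s. (iterate \<Phi> a k s, s k)) \<in> PiM I (\<lambda>_. D) \<rightarrow>\<^sub>M N \<Otimes>\<^sub>M D"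
      using Suc.IH by (intro measurable_Pair measurable_component_singleton) auto
    from measurable_compose[OF this \<Phi>[of k]] False show ?thesis by simp
  qed
qed

lemma iterate_cong:
  assumes "\<And>j. 1 \<le> j \<Longrightarrow> j < k \<Longrightarrow> s j = s' j"
  shows "iterate \<Phi> a k s = iterate \<Phi> a k s'"
  using assms by (induction k) auto

text \<open>Projection and retraction are continuous only over \<open>M\<close> and over the tangent bundle. The step is therefore
  composed through the Borel structures restricted to these sets.\<close>

lemma measurable_retraction_step:
  fixes M :: "'a::euclidean_space set"
  assumes M: "embedded_submanifold d M" and R: "manifold_retraction M Retr"
    and g: "(\<lambda>(y, s). g y s) \<in> borel_measurable (restrict_space borel M \<Otimes>\<^sub>M D)"
  shows "(\<lambda>(y, s). Retr y (c *\<^sub>R orth_proj (tangent_space M y) (g y s)))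
    \<in> restrict_space borel M \<Otimes>\<^sub>M D \<rightarrow>\<^sub>M restrict_space borel M"
proof -
  let ?N = "restrict_space borel M" and ?T = "SIGMA y:M. tangent_space M y"
  let ?P = "\<lambda>(y, v). orth_proj (tangent_space M y) v"
  have spN: "y \<in> M" if "(y, s) \<in> space (?N \<Otimes>\<^sub>M D)" for y s
    using that by (simp add: space_pair_measure space_restrict_space)
  have sub: "subspace (tangent_space M y)" if "y \<in> M" for y using subspace_tangent_space[OF M that] .
  have fst: "fst \<in> borel_measurable (?N \<Otimes>\<^sub>M D)"
    by (rule measurable_compose[OF measurable_fst measurable_restrict_space1]) simp
  have "(\<lambda>p. (fst p, case p of (y, s) \<Rightarrow> g y s)) \<in> ?N \<Otimes>\<^sub>M D \<rightarrow>\<^sub>M restrict_space borel (M \<times> UNIV)"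
    using spN by (intro measurable_restrict_space2 borel_measurable_Pair fst g) auto
  from measurable_compose[OF this borel_measurable_continuous_on_restrict[OF continuous_on_orth_proj_tangent_space[OF M]]]
  have p: "(\<lambda>p. ?P (fst p, case p of (y, s) \<Rightarrow> g y s)) \<in> borel_measurable (?N \<Otimes>\<^sub>M D)" .
  have "(\<lambda>p. (fst p, c *\<^sub>R ?P (fst p, case p of (y, s) \<Rightarrow> g y s))) \<in> ?N \<Otimes>\<^sub>M D \<rightarrow>\<^sub>M restrict_space borel ?T"
    using spN sub
    by (intro measurable_restrict_space2 borel_measurable_Pair fst borel_measurable_scaleR borel_measurable_const p)
      (auto intro!: subspace_scale orth_proj(1))
  from measurable_compose[OF this borel_measurable_continuous_on_restrict[OF continuous_on_retraction[OF R]]]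
  have "(\<lambda>(y, s). Retr y (c *\<^sub>R orth_proj (tangent_space M y) (g y s))) \<in> borel_measurable (?N \<Otimes>\<^sub>M D)"
    by (simp add: case_prod_beta')
  moreover have "Retr y (c *\<^sub>R orth_proj (tangent_space M y) v) \<in> M" if "y \<in> M" for y v
    using R that sub[OF that] orth_proj(1) unfolding manifold_retraction_def by (meson subspace_scale)
  ultimately show ?thesis using spN by (intro measurable_restrict_space2) auto
qed

text \<open>The \<open>k\<close>-th iterate depends only on the samples before step \<open>k\<close>, hence it is independent of the sample
  used in that step.\<close>

lemma (in prob_space)
  assumes ind: "indep_vars (\<lambda>_. D) \<xi> {1..}" and a: "a \<in> space N"
    and \<Phi>: "\<And>k. k \<ge> 1 \<Longrightarrow> (\<lambda>(y, s). \<Phi> k y s) \<in> N \<Otimes>\<^sub>M D \<rightarrow>\<^sub>M N"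
    and x1: "\<And>w. w \<in> space M \<Longrightarrow> x 1 w = a"
    and step: "\<And>k w. k \<ge> 1 \<Longrightarrow> w \<in> space M \<Longrightarrow> x (k + 1) w = \<Phi> k (x k w) (\<xi> k w)"
    and k: "k \<ge> (1::nat)"
  shows sampled_iterate_eq: "w \<in> space M \<Longrightarrow> x k w = iterate \<Phi> a k (\<lambda>j\<in>{1..}. \<xi> j w)"
    and sampled_iterate_measurable: "random_variable N (x k)"
    and sampled_iterate_joint_law:
      "distr M (N \<Otimes>\<^sub>M D) (\<lambda>w. (x k w, \<xi> k w)) = distr M N (x k) \<Otimes>\<^sub>M distr M D (\<xi> k)"
proof -
  have eq: "x j w = iterate \<Phi> a j (\<lambda>j\<in>{1..}. \<xi> j w)" if "w \<in> space M" "j \<ge> 1" for j w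
    using that(2)
  proof (induction j rule: dec_induct)
    case base
    then show ?case using x1[OF that(1)] by simp
  next
    case (step j)
    then show ?case using assms(5)[OF _ that(1), of j] by simp
  qed
  show "w \<in> space M \<Longrightarrow> x k w = iterate \<Phi> a k (\<lambda>j\<in>{1..}. \<xi> j w)" using eq k by blast
  have eq': "x k w = iterate \<Phi> a k (\<lambda>j\<in>{1..<k}. \<xi> j w)" if "w \<in> space M" for w
    unfolding eq[OF that k] by (rule iterate_cong) simp
  have \<xi>: "random_variable D (\<xi> j)" if "j \<ge> 1" for j
    using ind that unfolding indep_vars_def by auto
  have it: "iterate \<Phi> a k \<in> PiM {1..<k} (\<lambda>_. D) \<rightarrow>\<^sub>M N"
    by (rule measurable_iterate[OF a \<Phi> subset_refl])
  have "(\<lambda>w. \<lambda>j\<in>{1..<k}. \<xi> j w) \<in> M \<rightarrow>\<^sub>M PiM {1..<k} (\<lambda>_. D)"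
    using \<xi> by (intro measurable_restrict) auto
  from measurable_compose[OF this it]
  show "random_variable N (x k)" by (subst measurable_cong[OF eq'])
  have "indep_var (PiM {1..<k} (\<lambda>_. D)) (\<lambda>w. \<lambda>j\<in>{1..<k}. \<xi> j w) (PiM {k} (\<lambda>_. D)) (\<lambda>w. \<lambda>j\<in>{k}. \<xi> j w)"
    using k by (intro indep_var_restrict[OF ind]) auto
  from joint_law_compose[OF this it, of "\<lambda>s. s k" D]
  have "distr M (N \<Otimes>\<^sub>M D) (\<lambda>w. (iterate \<Phi> a k (\<lambda>j\<in>{1..<k}. \<xi> j w), \<xi> k w))
      = distr M N (\<lambda>w. iterate \<Phi> a k (\<lambda>j\<in>{1..<k}. \<xi> j w)) \<Otimes>\<^sub>M distr M D (\<xi> k)"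
    by simp
  then show "distr M (N \<Otimes>\<^sub>M D) (\<lambda>w. (x k w, \<xi> k w)) = distr M N (x k) \<Otimes>\<^sub>M distr M D (\<xi> k)"
    by (simp add: eq' cong: distr_cong)
qed

section \<open>Step sizes and epochs\<close>

text \<open>The step size is so small that \<open>lip * \<gamma> \<le> 2 / t\<^sup>2\<close>, where \<open>t\<close> stands for the fifth root of the index.
  At \<open>t = 1\<close> this allows the weight to vanish; as soon as \<open>t\<^sup>2 \<ge> 5 / 4\<close> the weight is at least
  \<open>2 / 5 * \<gamma>\<close>.\<close>

lemma
  fixes a b t lip \<omega> \<gamma> :: real
  assumes a: "a \<ge> 0" and b: "b > 0" and t: "t \<ge> 1" and lip: "lip = a + b * t"
    and \<omega>: "\<omega> = 2 * inverse (a + b) * b ^ 3" and \<gamma>: "\<gamma> = \<omega> / lip ^ 3"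
  shows step_weight_nonneg: "0 \<le> 2 * \<gamma> - lip * \<gamma>\<^sup>2"
    and step_noise_le: "lip * \<gamma>\<^sup>2 \<le> \<omega>\<^sup>2 / b ^ 5 / t ^ 5"
    and step_weight_ge: "5 / 4 \<le> t\<^sup>2 \<Longrightarrow> 2 / 5 * (\<omega> / (a + b) ^ 3) / t ^ 3 \<le> 2 * \<gamma> - lip * \<gamma>\<^sup>2"
proof -
  have bt: "b * t \<le> lip" "lip \<le> (a + b) * t"
    using lip a t mult_left_mono[of 1 t a] by (auto simp: algebra_simps)
  have pos: "0 < b * t" "0 < lip" "0 < a + b" using bt b t a mult_pos_pos[of b t] by linarith+
  have \<omega>0: "0 < \<omega>" using \<omega> b pos(3) by simp
  have "\<omega> = 2 * b\<^sup>2 * (b / (a + b))" unfolding \<omega> by (simp add: field_simps power2_eq_square power3_eq_cube)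
  also have "\<dots> \<le> 2 * b\<^sup>2 * 1" using a b by (intro mult_left_mono) auto
  finally have \<omega>b: "\<omega> \<le> 2 * b\<^sup>2" by simp
  have \<gamma>0: "0 < \<gamma>" unfolding \<gamma> using \<omega>0 pos by simp
  have "lip * \<gamma> = \<omega> / lip\<^sup>2" unfolding \<gamma> using pos by (simp add: power2_eq_square power3_eq_cube)
  also have "\<dots> \<le> (2 * b\<^sup>2) / (b * t)\<^sup>2"
    using \<omega>b bt pos by (intro frac_le power_mono) auto
  also have "\<dots> = 2 / t\<^sup>2" using b by (simp add: power_mult_distrib)
  finally have lg: "lip * \<gamma> \<le> 2 / t\<^sup>2" .
  have w: "2 * \<gamma> - lip * \<gamma>\<^sup>2 = \<gamma> * (2 - lip * \<gamma>)" by (simp add: power2_eq_square algebra_simps)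
  have "2 / t\<^sup>2 \<le> 2" using t by (simp add: field_simps)
  then show "0 \<le> 2 * \<gamma> - lip * \<gamma>\<^sup>2" unfolding w using lg \<gamma>0 by (intro mult_nonneg_nonneg) auto
  have "lip * \<gamma>\<^sup>2 = \<omega>\<^sup>2 / lip ^ 5"
  proof -
    have "lip ^ 3 * lip ^ 3 = lip * lip ^ 5" by (simp flip: power_add power_Suc)
    then have "lip * \<gamma>\<^sup>2 = lip * \<omega>\<^sup>2 / (lip * lip ^ 5)"
      unfolding \<gamma> power_divide by (simp add: power2_eq_square)
    also have "\<dots> = \<omega>\<^sup>2 / lip ^ 5" using pos(2) by (intro mult_divide_mult_cancel_left) simp
    finally show ?thesis .
  qed
  also have "\<dots> \<le> \<omega>\<^sup>2 / (b * t) ^ 5"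
    using bt pos by (intro divide_left_mono power_mono) auto
  finally show "lip * \<gamma>\<^sup>2 \<le> \<omega>\<^sup>2 / b ^ 5 / t ^ 5" by (simp add: power_mult_distrib)
  assume t2: "5 / 4 \<le> t\<^sup>2"
  then have "2 / t\<^sup>2 \<le> 8 / 5" using t by (simp add: field_simps)
  then have "2 / 5 \<le> 2 - lip * \<gamma>" using lg by linarith
  moreover have "\<omega> / ((a + b) * t) ^ 3 \<le> \<gamma>"
    unfolding \<gamma> using bt pos \<omega>0 by (intro divide_left_mono power_mono) auto
  ultimately have "\<omega> / ((a + b) * t) ^ 3 * (2 / 5) \<le> \<gamma> * (2 - lip * \<gamma>)"
    using \<gamma>0 by (intro mult_mono) auto
  then show "2 / 5 * (\<omega> / (a + b) ^ 3) / t ^ 3 \<le> 2 * \<gamma> - lip * \<gamma>\<^sup>2"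
    unfolding w by (simp add: power_mult_distrib mult.commute)
qed

lemma fifth_root_power5: "(x powr (1 / 5)) ^ 5 = x" if "x > 0" for x :: real
  using that by (simp add: powr_power)

lemma epoch_fifth_root_bounds:
  assumes "k \<in> epoch l"
  shows "(2 ^ l) powr (1 / 5) \<le> real k powr (1 / 5)" "real k powr (1 / 5) \<le> 2 * (2 ^ l) powr (1 / 5)"
proof -
  have "2 ^ l \<le> k" "k \<le> 2 ^ Suc l" using assms unfolding epoch_def by auto
  then have "2 ^ l \<le> real k" "real k \<le> 2 ^ Suc l"
    by (simp_all only: numeral_power_le_of_nat_cancel_iff of_nat_le_numeral_power_cancel_iff)
  then have k: "2 ^ l \<le> real k" "real k \<le> 2 * 2 ^ l" by simp_all
  show "(2 ^ l) powr (1 / 5) \<le> real k powr (1 / 5)" using k by (intro powr_mono2) auto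
  have "real k powr (1 / 5) \<le> (2 * 2 ^ l) powr (1 / 5)" using k by (intro powr_mono2) auto
  also have "\<dots> = 2 powr (1 / 5) * (2 ^ l) powr (1 / 5)" by (simp add: powr_mult)
  also have "\<dots> \<le> 2 * (2 ^ l) powr (1 / 5)"
    using powr_mono[of "1 / 5" 1 "2::real"] by (intro mult_right_mono) auto
  finally show "real k powr (1 / 5) \<le> 2 * (2 ^ l) powr (1 / 5)" .
qed

lemma card_epoch: "finite (epoch l)" "card (epoch l) = 2 ^ l"
  unfolding epoch_def by auto

lemma epoch_pos: "k \<in> epoch l \<Longrightarrow> k \<ge> 1"
  unfolding epoch_def by (metis atLeastLessThan_iff le_trans one_le_numeral one_le_power)

text \<open>The unnormalised total weight \<open>sum w I\<close> is of order \<open>1 / s\<^sup>2\<close> while the weighted sum of \<open>V\<close> stays bounded, so the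
  average of \<open>V\<close> is of order \<open>s\<^sup>2\<close> and that of \<open>V / (2 * s)\<close> of order \<open>s\<close>.\<close>

lemma weighted_average_le:
  fixes w p V g :: "'i \<Rightarrow> real"
  assumes fin: "finite I" and w: "\<And>k. k \<in> I \<Longrightarrow> 0 \<le> w k" and p: "\<And>k. k \<in> I \<Longrightarrow> p k * sum w I = w k"
    and c: "c > 0" "s > 0" and W: "c / s\<^sup>2 \<le> sum w I" and V: "(\<Sum>k\<in>I. w k * V k) \<le> C" and C: "C \<ge> 0"
    and g: "\<And>k. k \<in> I \<Longrightarrow> g k \<le> V k / (2 * s) + c' * s"
  shows "(\<Sum>k\<in>I. p k) = 1" and "(\<Sum>k\<in>I. p k * g k) \<le> (C / (2 * c) + c') * s"
proof -
  let ?W = "sum w I"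
  have "0 < c / s\<^sup>2" using c by simp
  then have W0: "?W > 0" using W by linarith
  have pw: "p k = w k / ?W" if "k \<in> I" for k using p[OF that] W0 by (simp add: field_simps)
  have p0: "0 \<le> p k" if "k \<in> I" for k using pw[OF that] w[OF that] W0 by simp
  have "(\<Sum>k\<in>I. p k) * ?W = ?W" unfolding sum_distrib_right using p by simp
  then show p1: "(\<Sum>k\<in>I. p k) = 1" using W0 by simp
  have "(\<Sum>k\<in>I. p k * g k) \<le> (\<Sum>k\<in>I. p k * (V k / (2 * s) + c' * s))"
    using g p0 by (intro sum_mono mult_left_mono) auto
  also have "\<dots> = (\<Sum>k\<in>I. p k * V k) / (2 * s) + (\<Sum>k\<in>I. p k) * (c' * s)"
    unfolding distrib_left sum.distrib sum_divide_distrib sum_distrib_right by simp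
  also have "(\<Sum>k\<in>I. p k * V k) = (\<Sum>k\<in>I. w k * V k) / ?W"
    unfolding sum_divide_distrib using pw by (intro sum.cong) auto
  also have "\<dots> \<le> C / (c / s\<^sup>2)"
    using V W W0 C c by (intro order_trans[OF divide_right_mono[OF V] divide_left_mono[OF W C]]) auto
  also have "C / (c / s\<^sup>2) = C / c * s\<^sup>2" by simp
  finally have "(\<Sum>k\<in>I. p k * g k) \<le> C / c * s\<^sup>2 / (2 * s) + c' * s"
    using p1 c by (simp add: divide_right_mono)
  then show "(\<Sum>k\<in>I. p k * g k) \<le> (C / (2 * c) + c') * s"
    using c by (simp add: field_simps power2_eq_square)
qed

lemma exists_epoch_of_size:
  fixes X :: real
  shows "\<exists>l\<ge>1. X \<le> 2 ^ l \<and> 2 ^ (l + 1) \<le> 4 * max 1 X"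
proof -
  obtain n0 where n0: "X < 2 ^ n0" using real_arch_pow[of 2 X] by auto
  define n where "n = (LEAST n. X \<le> 2 ^ Suc n)"
  have "X \<le> 2 ^ Suc n0" using n0 power_increasing[of n0 "Suc n0" "2::real"] by linarith
  then have n: "X \<le> 2 ^ Suc n" unfolding n_def by (rule LeastI)
  have "2 ^ (Suc n + 1) \<le> 4 * max 1 X"
  proof (cases n)
    case (Suc m)
    then have "\<not> X \<le> 2 ^ Suc m" using not_less_Least[of m "\<lambda>n. X \<le> 2 ^ Suc n"] unfolding n_def by simp
    then show ?thesis unfolding Suc by simp
  qed simp
  then show ?thesis using n by (intro exI[of _ "Suc n"]) simp
qed

lemma exists_le_weighted_average:
  fixes p g :: "'i \<Rightarrow> real"
  assumes "finite I" "(\<Sum>k\<in>I. p k) = 1" "\<And>k. k \<in> I \<Longrightarrow> 0 \<le> p k" "(\<Sum>k\<in>I. p k * g k) \<le> e"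
  shows "\<exists>k\<in>I. g k \<le> e"
proof (rule ccontr)
  assume "\<not> ?thesis"
  then have lt: "\<And>k. k \<in> I \<Longrightarrow> e < g k" by force
  obtain j where j: "j \<in> I" "p j > 0"
    using assms(2,3) by (metis (no_types, lifting) less_eq_real_def sum.neutral zero_neq_one)
  have "(\<Sum>k\<in>I. p k * e) < (\<Sum>k\<in>I. p k * g k)"
    using assms(1,3) lt j by (intro sum_strict_mono_ex1 bexI[of _ j]) (auto intro: mult_left_mono less_imp_le)
  then show False using assms(2,4) by (simp flip: sum_distrib_right)
qed

section \<open>Complexity of the epoch method\<close>

theorem theorem6:
  fixes M :: "(real ^ 'n) set" and d :: nat
    and D :: "'s measure"
    and fs :: "real ^ 'n \<Rightarrow> 's \<Rightarrow> real" and gs :: "real ^ 'n \<Rightarrow> 's \<Rightarrow> real ^ 'n"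
    and f :: "real ^ 'n \<Rightarrow> real" and h :: "real ^ 'm \<Rightarrow> real" and A :: "real ^ 'n \<Rightarrow> real ^ 'm"
    and Retr :: "real ^ 'n \<Rightarrow> real ^ 'n \<Rightarrow> real ^ 'n"
    and lf lh \<rho> \<alpha> \<beta> \<sigma> G \<omega>\<^sub>1 \<omega>\<^sub>4 \<omega> :: real
    and \<mu> lip \<gamma> :: "nat \<Rightarrow> real"
    and P :: "'w measure" and \<xi> :: "nat \<Rightarrow> 'w \<Rightarrow> 's" and R :: "nat \<Rightarrow> 'w \<Rightarrow> nat"
    and x\<^sub>1 :: "real ^ 'n" and x :: "nat \<Rightarrow> 'w \<Rightarrow> real ^ 'n"
  assumes manifold: "compact M" "embedded_submanifold d M"
    and sample_space: "prob_space D"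
    and f_expectation: "\<And>y. integrable D (fs y)" "\<And>y. f y = (\<integral>s. fs y s \<partial>D)"
    and f_smooth: "\<And>y. f differentiable (at y)" "lf-lipschitz_on UNIV (gradient f)"
    and h: "\<rho> > 0" "weakly_convex \<rho> h" "lh-lipschitz_on UNIV h"
    and A: "linear A" "A \<noteq> (\<lambda>_. 0)" "surj A"
    and bounded_below: "bdd_below (range (\<lambda>y. f y + h (A y)))"
    and retraction: "manifold_retraction M Retr" "\<alpha> > 0" "\<beta> > 0"
      "\<And>y u. y \<in> M \<Longrightarrow> u \<in> tangent_space M y \<Longrightarrow> norm (Retr y u - y) \<le> \<alpha> * norm u"
      "\<And>y u. y \<in> M \<Longrightarrow> u \<in> tangent_space M y \<Longrightarrow> norm (Retr y u - y - u) \<le> \<beta> * (norm u)\<^sup>2"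
    and stoch_grad: "(\<lambda>(y, s). gs y s) \<in> borel_measurable (borel \<Otimes>\<^sub>M D)"
      "\<And>y. integrable D (gs y)" "\<And>y. (\<integral>s. gs y s \<partial>D) = gradient f y"
    and variance: "\<sigma> > 0" "\<And>y. integrable D (\<lambda>s. (norm (gs y s - gradient f y))\<^sup>2)"
      "\<And>y. (\<integral>s. (norm (gs y s - gradient f y))\<^sup>2 \<partial>D) \<le> \<sigma>\<^sup>2"
    and G: "\<And>k y. k \<ge> 1 \<Longrightarrow> y \<in> M \<Longrightarrow> norm (gradient (smoothed f h A (\<mu> k)) y) \<le> G"
    and \<omega>\<^sub>1: "\<omega>\<^sub>1 = \<alpha>\<^sup>2 * lf + 2 * G * \<beta> + 2 * \<rho> * \<alpha>\<^sup>2 * (onorm A)\<^sup>2"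
    and \<omega>\<^sub>4: "\<omega>\<^sub>4 = 2 * \<rho> * \<alpha>\<^sup>2 * (onorm A)\<^sup>2"
    and \<omega>: "\<omega> = 2 * inverse \<omega>\<^sub>1 * \<omega>\<^sub>4 ^ 3"
    and \<mu>: "\<And>k. k \<ge> 1 \<Longrightarrow> \<mu> k = inverse (2 * \<rho>) * real k powr (- 1 / 5)"
    and lip: "\<And>k. k \<ge> 1 \<Longrightarrow> lip k = \<alpha>\<^sup>2 * lf + \<alpha>\<^sup>2 * (onorm A)\<^sup>2 * inverse (\<mu> k) + 2 * G * \<beta>"
    and \<gamma>: "\<And>k. k \<ge> 1 \<Longrightarrow> \<gamma> k = \<omega> / lip k ^ 3"
    and probability_space: "prob_space P"
    and choices: "independent_choices P D \<xi> R"
      "\<And>l. epoch_index P (\<lambda>k. 2 * \<gamma> k - lip k * (\<gamma> k)\<^sup>2) l (R l)"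
    and init: "x\<^sub>1 \<in> M" "\<And>w. w \<in> space P \<Longrightarrow> x 1 w = x\<^sub>1"
    and step: "\<And>k w. k \<ge> 1 \<Longrightarrow> w \<in> space P \<Longrightarrow>
      x (k + 1) w = Retr (x k w) (- \<gamma> k *\<^sub>R stoch_rgrad M h A (\<mu> k) (x k w) (gs (x k w) (\<xi> k w)))"
  shows "\<exists>C>0. \<forall>\<epsilon>>0. \<exists>l. \<exists>k\<in>epoch l. \<forall>k'\<in>{R l, \<lambda>_. k}.
    let x' = (\<lambda>w. x (k' w) w);
        xhat = (\<lambda>w. prox_point A h (\<mu> (k' w)) (x' w));
        gap = (\<lambda>w. stationarity_gap M f h A (x' w) (xhat w) (A (xhat w)))
    in (\<forall>w\<in>space P. real (k' w) \<le> C * max 1 (1 / \<epsilon> ^ 5)) \<and>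
       integrable P gap \<and> (\<integral>w. gap w \<partial>P) \<le> \<epsilon> \<and>
       (\<forall>w\<in>space P. norm (x' w - xhat w) \<le> \<epsilon>)"
proof -
  interpret prob_space P by (rule probability_space)
  \<comment> \<open>projection and retraction are regular only over \<open>M\<close>, so the iterates are random variables into the Borel structure of \<open>M\<close>\<close>
  define N where "N = restrict_space borel M"
  define F where "F k = smoothed f h A (\<mu> k)" for k
  define v where "v k y = stoch_rgrad M h A (\<mu> k) y (gradient f y)" for k y
  define xh where "xh k = prox_point A h (\<mu> k)" for k
  define q where "q k y = stationarity_gap M f h A y (xh k y) (A (xh k y))" for k y
  define t where "t k = real k powr (1 / 5)" for k :: nat
  define wt where "wt k = 2 * \<gamma> k - lip k * (\<gamma> k)\<^sup>2" for k
  define a where "a = \<alpha>\<^sup>2 * lf + 2 * G * \<beta>"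
  have spN: "space N = M" unfolding N_def by (simp add: space_restrict_space)
  have clM: "closed M" using manifold(1) by (rule compact_imp_closed)
  have lf: "lf \<ge> 0" using f_smooth(2) by (rule lipschitz_on_nonneg)
  have lh: "lh \<ge> 0" using h(3) by (rule lipschitz_on_nonneg)
  have G0: "G \<ge> 0" using G[of 1 x\<^sub>1] init(1) norm_ge_zero order_trans by blast
  have blA: "bounded_linear A" using A(1) linear_conv_bounded_linear by blast
  have sub: "subspace (tangent_space M y)" if "y \<in> M" for y
    using subspace_tangent_space[OF manifold(2) that] .

  \<comment> \<open>all parameters are rational functions of the fifth root \<open>t k\<close> of the index\<close>
  have t1: "t k \<ge> 1" and t5: "t k ^ 5 = real k" if "k \<ge> 1" for k
    using that ge_one_powr_ge_zero[of "real k" "1 / 5"] fifth_root_power5[of "real k"] unfolding t_def by auto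
  have \<mu>t: "\<mu> k = inverse (2 * \<rho>) / t k" if "k \<ge> 1" for k
    unfolding \<mu>[OF that] t_def by (simp add: powr_minus_divide)
  have \<mu>0: "\<mu> k > 0" if "k \<ge> 1" for k
    using h(1) t1[OF that] unfolding \<mu>t[OF that] by simp
  have \<mu>\<rho>: "\<mu> k * \<rho> < 1" if "k \<ge> 1" for k
    using h(1) t1[OF that] unfolding \<mu>t[OF that] by (simp add: field_simps)
  have \<mu>le: "\<mu> k \<le> inverse (2 * \<rho>)" if "k \<ge> 1" for k
    using h(1) t1[OF that] unfolding \<mu>t[OF that] by (simp add: field_simps)
  have a0: "a \<ge> 0" unfolding a_def using lf G0 retraction(3) by simp
  have b0: "\<omega>\<^sub>4 > 0" unfolding \<omega>\<^sub>4 using h(1) retraction(2) onorm_pos_lt[OF blA] A(2) by (auto simp: fun_eq_iff)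
  have lipt: "lip k = a + \<omega>\<^sub>4 * t k" if "k \<ge> 1" for k
    unfolding lip[OF that] \<mu>t[OF that] a_def \<omega>\<^sub>4 using h(1) by (simp add: field_simps)
  have \<omega>': "\<omega> = 2 * inverse (a + \<omega>\<^sub>4) * \<omega>\<^sub>4 ^ 3" unfolding \<omega> \<omega>\<^sub>1 \<omega>\<^sub>4 a_def by simp
  have lip0: "lip k \<ge> 0" if "k \<ge> 1" for k
    unfolding lipt[OF that] using a0 b0 t1[OF that] by simp
  have wt0: "0 \<le> wt k" if "k \<ge> 1" for k
    unfolding wt_def using step_weight_nonneg[OF a0 b0 t1[OF that] lipt[OF that] \<omega>' \<gamma>[OF that]] .

  have cF: "continuous_on S (F k)" if "k \<ge> 1" for k S
    unfolding F_def by (rule continuous_on_smoothed[OF f_smooth h(3,2) A(1) \<mu>0[OF that] \<mu>\<rho>[OF that]])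
  have vn: "norm (v k y) \<le> G" if "k \<ge> 1" "y \<in> M" for k y
  proof -
    have "v k y = orth_proj (tangent_space M y) (gradient (F k) y)"
      unfolding v_def F_def stoch_rgrad_eq[OF f_smooth h(3,2) A(1) \<mu>0[OF that(1)] \<mu>\<rho>[OF that(1)]] by simp
    then show ?thesis
      using norm_orth_proj_le[OF sub[OF that(2)]] G[OF that] unfolding F_def by (metis order_trans)
  qed
  \<comment> \<open>the envelopes differ from \<open>h\<close> by at most \<open>lh\<^sup>2 / \<rho>\<close>, so compactness of \<open>M\<close> bounds all \<open>F k\<close> at once\<close>
  obtain B where B: "\<And>k y. k \<ge> 1 \<Longrightarrow> y \<in> M \<Longrightarrow> \<bar>F k y\<bar> \<le> B" and B0: "B \<ge> 0"
  proof -
    have "continuous_on M (\<lambda>y. f y + h (A y))"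
    proof (intro continuous_intros)
      show "continuous_on M f"
        using f_smooth(1) by (intro differentiable_imp_continuous_on) (auto simp: differentiable_on_def intro: differentiable_at_withinI)
      show "continuous_on M (\<lambda>y. h (A y))"
        by (rule continuous_on_compose2[OF lipschitz_on_continuous_on[OF h(3)] linear_continuous_on[OF blA]]) simp
    qed
    then have "bounded ((\<lambda>y. f y + h (A y)) ` M)"
      using manifold(1) compact_continuous_image compact_imp_bounded by blast
    then obtain B' where B': "\<And>y. y \<in> M \<Longrightarrow> \<bar>f y + h (A y)\<bar> \<le> B'"
      unfolding bounded_iff by auto
    define c where "c = 2 * inverse (2 * \<rho>) * lh\<^sup>2"
    have c0: "c \<ge> 0" unfolding c_def using h(1) by simp
    have "\<bar>F k y\<bar> \<le> B' + c" if "k \<ge> 1" "y \<in> M" for k y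
    proof -
      have "2 * \<mu> k * lh\<^sup>2 \<le> c"
        unfolding c_def using \<mu>le[OF that(1)] by (intro mult_right_mono mult_left_mono) auto
      then show ?thesis
        using moreau_env_bounds[OF h(3) \<mu>0[OF that(1)], of "A y"] B'[OF that(2)] c0
        unfolding F_def smoothed_def by linarith
    qed
    moreover have "B' + c \<ge> 0" using B'[OF init(1)] c0 by linarith
    ultimately show thesis using that by blast
  qed
  have Fdec: "F (Suc k) y \<le> F k y + 4 * lh\<^sup>2 * (\<mu> k - \<mu> (Suc k))" if k: "k \<ge> 1" for k y
  proof -
    have "t k \<le> t (Suc k)" unfolding t_def by (intro powr_mono2) auto
    then have 1: "\<mu> (Suc k) \<le> \<mu> k"
      using h(1) t1[OF k] t1[of "Suc k"] unfolding \<mu>t[OF k] \<mu>t[OF le_SucI[OF k]]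
      by (intro divide_left_mono mult_pos_pos) auto
    have "t (Suc k) ^ 5 \<le> (2 * t k) ^ 5" using t5[OF k] t5[of "Suc k"] k by (simp add: power_mult_distrib)
    then have "t (Suc k) \<le> 2 * t k"
      using t1[OF k] power_mono_iff[of "t (Suc k)" "2 * t k" 5] t1[of "Suc k"] by simp
    then have 2: "\<mu> k \<le> 2 * \<mu> (Suc k)"
      using h(1) t1[OF k] t1[of "Suc k"] unfolding \<mu>t[OF k] \<mu>t[OF le_SucI[OF k]] by (simp add: field_simps)
    show ?thesis
      using moreau_env_decrease_parameter[OF \<mu>0[OF le_SucI[OF k]] 1 2 h(3), of "A y"]
      unfolding F_def smoothed_def by simp
  qed

  define \<Phi> where "\<Phi> k y s = Retr y (- \<gamma> k *\<^sub>R stoch_rgrad M h A (\<mu> k) y (gs y s))" for k y s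
  have gsN: "(\<lambda>(y, s). gs y s) \<in> borel_measurable (N \<Otimes>\<^sub>M D)"
  proof -
    have "(\<lambda>p. (fst p, snd p)) \<in> N \<Otimes>\<^sub>M D \<rightarrow>\<^sub>M borel \<Otimes>\<^sub>M D"
      unfolding N_def
      by (intro measurable_Pair measurable_snd measurable_compose[OF measurable_fst measurable_restrict_space1]) simp
    from measurable_compose[OF this stoch_grad(1)] show ?thesis by simp
  qed
  have cN: "\<phi> \<in> borel_measurable N" if "continuous_on M \<phi>" for \<phi> :: "real ^ 'n \<Rightarrow> 'z::topological_space"
    unfolding N_def using that by (rule borel_measurable_continuous_on_restrict)
  have \<Phi>: "(\<lambda>(y, s). \<Phi> k y s) \<in> N \<Otimes>\<^sub>M D \<rightarrow>\<^sub>M N" if k: "k \<ge> 1" for k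
  proof -
    have "continuous_on M (\<lambda>y. gradient (smoothed f h A (\<mu> k)) y - gradient f y)"
      by (intro continuous_intros continuous_on_gradient_smoothed[OF f_smooth h(3,2) A(1) \<mu>0[OF k] \<mu>\<rho>[OF k]]
          continuous_on_subset[OF lipschitz_on_continuous_on[OF f_smooth(2)]]) simp
    then have "continuous_on M (\<lambda>y. (1 / \<mu> k) *\<^sub>R adjoint A (A y - prox (\<mu> k) h (A y)))"
      unfolding gradient_smoothed[OF f_smooth h(3,2) A(1) \<mu>0[OF k] \<mu>\<rho>[OF k]] by simp
    from borel_measurable_add[OF gsN measurable_compose[OF measurable_fst cN[OF this]]]
    have "(\<lambda>(y, s). gs y s + (1 / \<mu> k) *\<^sub>R adjoint A (A y - prox (\<mu> k) h (A y))) \<in> borel_measurable (N \<Otimes>\<^sub>M D)"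
      by (simp add: case_prod_beta')
    from measurable_retraction_step[OF manifold(2) retraction(1) this[unfolded N_def], of "- \<gamma> k"]
    show ?thesis unfolding \<Phi>_def stoch_rgrad_def N_def .
  qed
  have ind: "indep_vars (\<lambda>_. D) \<xi> {1..}" and law: "\<And>k. k \<ge> 1 \<Longrightarrow> distr P D (\<xi> k) = D"
    and Rind: "indep_vars (\<lambda>_. count_space UNIV) R UNIV"
    using choices(1) unfolding independent_choices_def by blast+
  have aN: "x\<^sub>1 \<in> space N" using init(1) spN by simp
  have step': "x (k + 1) w = \<Phi> k (x k w) (\<xi> k w)" if "k \<ge> 1" "w \<in> space P" for k w
    unfolding \<Phi>_def using step[OF that] .
  have it: "w \<in> space P \<Longrightarrow> x k w = iterate \<Phi> x\<^sub>1 k (\<lambda>j\<in>{1..}. \<xi> j w)"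
    and xN: "random_variable N (x k)"
    and joint: "distr P (N \<Otimes>\<^sub>M D) (\<lambda>w. (x k w, \<xi> k w)) = distr P N (x k) \<Otimes>\<^sub>M distr P D (\<xi> k)"
    if "k \<ge> 1" for k w
    using sampled_iterate_eq[where \<Phi>=\<Phi> and N=N and D=D, OF ind aN \<Phi> init(2) step' that]
      sampled_iterate_measurable[where \<Phi>=\<Phi> and N=N and D=D, OF ind aN \<Phi> init(2) step' that]
      sampled_iterate_joint_law[where \<Phi>=\<Phi> and N=N and D=D, OF ind aN \<Phi> init(2) step' that] by blast+
  have \<xi>m: "random_variable D (\<xi> k)" if "k \<ge> 1" for k
    using ind that unfolding indep_vars_def by auto
  have Rm: "random_variable (count_space UNIV) (R l)" for l
    using Rind unfolding indep_vars_def by auto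
  have xM: "x k w \<in> M" if "k \<ge> 1" "w \<in> space P" for k w
    using measurable_space[OF xN[OF that(1)] that(2)] spN by simp
  have bint: "integrable P (\<lambda>w. \<phi> (x k w))" if "k \<ge> 1" "\<phi> \<in> borel_measurable N" "\<And>y. y \<in> M \<Longrightarrow> \<bar>\<phi> y\<bar> \<le> C"
    for \<phi> :: "_ \<Rightarrow> real" and C k
    using that xM by (intro integrable_const_bound[where B=C] measurable_compose[OF xN]) (auto intro!: AE_I2)
  have vm: "v k \<in> borel_measurable N" if k: "k \<ge> 1" for k
  proof -
    have "continuous_on M (gradient (F k))"
      unfolding F_def by (rule continuous_on_gradient_smoothed[OF f_smooth h(3,2) A(1) \<mu>0[OF k] \<mu>\<rho>[OF k]])
    then have "continuous_on M (\<lambda>y. (case (y, gradient (F k) y) of (y, u) \<Rightarrow> orth_proj (tangent_space M y) u))"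
      by (intro continuous_on_compose2[OF continuous_on_orth_proj_tangent_space[OF manifold(2)]] continuous_intros) auto
    then have "continuous_on M (v k)"
      unfolding v_def[abs_def] F_def stoch_rgrad_eq[OF f_smooth h(3,2) A(1) \<mu>0[OF k] \<mu>\<rho>[OF k]] by simp
    then show ?thesis by (rule cN)
  qed
  define V where "V k = expectation (\<lambda>w. (norm (v k (x k w)))\<^sup>2)" for k
  define e where "e k = expectation (\<lambda>w. F k (x k w))" for k
  have Vint: "integrable P (\<lambda>w. (norm (v k (x k w)))\<^sup>2)" if k: "k \<ge> 1" for k
    using vm[OF k] vn[OF k] by (intro bint[OF k, of "\<lambda>y. (norm (v k y))\<^sup>2" "G\<^sup>2"]) (auto intro: power_mono)
  have Fint: "integrable P (\<lambda>w. F j (x k w))" if "j \<ge> 1" "k \<ge> 1" for j k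
    using B[OF that(1)] by (intro bint[OF that(2)] cN cF that)
  have e_bound: "\<bar>e k\<bar> \<le> B" if k: "k \<ge> 1" for k
  proof -
    have "e k \<le> expectation (\<lambda>_. B)" "expectation (\<lambda>_. - B) \<le> e k"
      unfolding e_def using B[OF k] xM[OF k] by (intro integral_mono Fint k integrable_const; force simp: abs_le_iff)+
    then show ?thesis by (simp add: prob_space abs_le_iff)
  qed

  \<comment> \<open>the factor \<open>2\<close> turns the coefficient of the squared gradient into the weight \<open>wt k\<close>\<close>
  have descent: "wt k * V k \<le> 2 * e k - 2 * e (Suc k) + 8 * lh\<^sup>2 * (\<mu> k - \<mu> (Suc k)) + lip k * (\<gamma> k)\<^sup>2 * \<sigma>\<^sup>2"
    if k: "k \<ge> 1" for k
  proof -
    define n where "n y s = gs y s - gradient f y" for y s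
    have gfN: "gradient f \<in> borel_measurable N"
      by (rule cN[OF continuous_on_subset[OF lipschitz_on_continuous_on[OF f_smooth(2)]]]) simp
    have nm: "(\<lambda>(y, s). n y s) \<in> borel_measurable (N \<Otimes>\<^sub>M D)"
      using borel_measurable_diff[OF gsN measurable_compose[OF measurable_fst gfN]]
      unfolding n_def by (simp add: case_prod_beta')
    interpret D: prob_space D by (rule sample_space)
    have n1: "integrable D (n y)" "(\<integral>s. n y s \<partial>D) = 0" for y
      unfolding n_def using stoch_grad(2,3) D.prob_space by simp_all
    have n2: "integrable D (\<lambda>s. (norm (n y s))\<^sup>2)" "(\<integral>s. (norm (n y s))\<^sup>2 \<partial>D) \<le> \<sigma>\<^sup>2" for y
      unfolding n_def using variance(2,3) by simp_all
    have vn': "norm (v k y) \<le> G" if "y \<in> space N" for y using vn[OF k] that spN by simp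
    note noise = centred_noise_expectations[OF xN[OF k] \<xi>m[OF k] law[OF k] joint[OF k] nm n1 n2 vm[OF k] vn']
    let ?n = "\<lambda>w. n (x k w) (\<xi> k w)" and ?v = "\<lambda>w. v k (x k w)"
    have pt: "F (Suc k) (x (Suc k) w) \<le> F k (x k w) - (\<gamma> k - lip k * (\<gamma> k)\<^sup>2 / 2) * (norm (?v w))\<^sup>2
        - (\<gamma> k - lip k * (\<gamma> k)\<^sup>2) * (?v w \<bullet> ?n w) + lip k * (\<gamma> k)\<^sup>2 / 2 * (norm (?n w))\<^sup>2
        + 4 * lh\<^sup>2 * (\<mu> k - \<mu> (Suc k))" if w: "w \<in> space P" for w
    proof -
      have y: "x k w \<in> M" using xM[OF k w] .
      have "F k (Retr (x k w) (- \<gamma> k *\<^sub>R stoch_rgrad M h A (\<mu> k) (x k w) (gs (x k w) (\<xi> k w))))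
        \<le> F k (x k w) - (\<gamma> k - lip k * (\<gamma> k)\<^sup>2 / 2) * (norm (?v w))\<^sup>2
        - (\<gamma> k - lip k * (\<gamma> k)\<^sup>2) * (?v w \<bullet> ?n w) + lip k * (\<gamma> k)\<^sup>2 / 2 * (norm (?n w))\<^sup>2"
        unfolding F_def v_def n_def
        by (rule smoothed_retraction_step[OF f_smooth h(3,2) A(1) \<mu>0[OF k] \<mu>\<rho>[OF k] sub[OF y] G0 G[OF k y]
            retraction(4)[OF y] retraction(5)[OF y] lip[OF k] lip0[OF k]])
      then show ?thesis using Fdec[OF k, of "x (Suc k) w"] step[OF k w] by simp
    qed
    have "e (Suc k) \<le> expectation (\<lambda>w. F k (x k w) - (\<gamma> k - lip k * (\<gamma> k)\<^sup>2 / 2) * (norm (?v w))\<^sup>2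
        - (\<gamma> k - lip k * (\<gamma> k)\<^sup>2) * (?v w \<bullet> ?n w) + lip k * (\<gamma> k)\<^sup>2 / 2 * (norm (?n w))\<^sup>2
        + 4 * lh\<^sup>2 * (\<mu> k - \<mu> (Suc k)))"
      unfolding e_def using k
      by (intro integral_mono pt Fint Bochner_Integration.integrable_add Bochner_Integration.integrable_diff
          integrable_mult_right Vint noise(1,3) integrable_const) auto
    also have "\<dots> = e k - (\<gamma> k - lip k * (\<gamma> k)\<^sup>2 / 2) * V k - (\<gamma> k - lip k * (\<gamma> k)\<^sup>2) * expectation (\<lambda>w. ?v w \<bullet> ?n w)
        + lip k * (\<gamma> k)\<^sup>2 / 2 * expectation (\<lambda>w. (norm (?n w))\<^sup>2) + 4 * lh\<^sup>2 * (\<mu> k - \<mu> (Suc k))"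
      unfolding e_def V_def using k Fint[OF k k] Vint[OF k] noise(1,3)
      by (simp add: prob_space)
    also have "\<dots> \<le> e k - (\<gamma> k - lip k * (\<gamma> k)\<^sup>2 / 2) * V k + lip k * (\<gamma> k)\<^sup>2 / 2 * \<sigma>\<^sup>2 + 4 * lh\<^sup>2 * (\<mu> k - \<mu> (Suc k))"
      using noise(4) mult_left_mono[OF noise(2), of "lip k * (\<gamma> k)\<^sup>2 / 2"] lip0[OF k] by simp
    finally show ?thesis unfolding wt_def by (simp add: algebra_simps)
  qed
  define C3 where "C3 = 4 * B + 8 * lh\<^sup>2 * inverse (2 * \<rho>) + \<omega>\<^sup>2 / \<omega>\<^sub>4 ^ 5 * \<sigma>\<^sup>2"
  have C30: "C3 \<ge> 0" unfolding C3_def using B0 h(1) b0 by simp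
  \<comment> \<open>no dependence on \<open>l\<close>: the differences telescope, and the noise is a sum of \<open>2 ^ l\<close> terms of size \<open>O(1 / 2 ^ l)\<close>\<close>
  have epoch_sum: "(\<Sum>k\<in>epoch l. wt k * V k) \<le> C3" for l
  proof -
    let ?m = "2 ^ l :: nat" and ?M = "2 ^ (l + 1) :: nat"
    have ge1: "k \<ge> 1" if "k \<in> epoch l" for k using epoch_pos[OF that] .
    have "(\<Sum>k\<in>epoch l. wt k * V k) \<le> (\<Sum>k\<in>epoch l. (2 * e k - 2 * e (Suc k) + 8 * lh\<^sup>2 * (\<mu> k - \<mu> (Suc k))) + lip k * (\<gamma> k)\<^sup>2 * \<sigma>\<^sup>2)"
      using descent ge1 by (intro sum_mono) auto
    also have "\<dots> = (\<Sum>k\<in>epoch l. 2 * e k - 2 * e (Suc k) + 8 * lh\<^sup>2 * (\<mu> k - \<mu> (Suc k))) + (\<Sum>k\<in>epoch l. lip k * (\<gamma> k)\<^sup>2) * \<sigma>\<^sup>2"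
      by (simp add: sum.distrib sum_distrib_right)
    also have "(\<Sum>k\<in>epoch l. 2 * e k - 2 * e (Suc k) + 8 * lh\<^sup>2 * (\<mu> k - \<mu> (Suc k)))
        = (\<Sum>k\<in>{?m..<?M}. (- 2 * e (Suc k) - 8 * lh\<^sup>2 * \<mu> (Suc k)) - (- 2 * e k - 8 * lh\<^sup>2 * \<mu> k))"
      unfolding epoch_def by (intro sum.cong) (auto simp: algebra_simps)
    also have "\<dots> = (- 2 * e ?M - 8 * lh\<^sup>2 * \<mu> ?M) - (- 2 * e ?m - 8 * lh\<^sup>2 * \<mu> ?m)"
      by (rule sum_Suc_diff') simp
    also have "\<dots> \<le> 4 * B + 8 * lh\<^sup>2 * inverse (2 * \<rho>)"
    proof -
      have "0 \<le> 8 * lh\<^sup>2 * \<mu> ?M" using \<mu>0[of ?M] by simp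
      moreover have "8 * lh\<^sup>2 * \<mu> ?m \<le> 8 * lh\<^sup>2 * inverse (2 * \<rho>)"
        using \<mu>le[of ?m] by (intro mult_left_mono) auto
      moreover have "\<bar>e ?m\<bar> \<le> B" "\<bar>e ?M\<bar> \<le> B" using e_bound by simp_all
      ultimately show ?thesis by linarith
    qed
    also have "(\<Sum>k\<in>epoch l. lip k * (\<gamma> k)\<^sup>2) \<le> \<omega>\<^sup>2 / \<omega>\<^sub>4 ^ 5"
    proof -
      have "(\<Sum>k\<in>epoch l. lip k * (\<gamma> k)\<^sup>2) \<le> (\<Sum>k\<in>epoch l. \<omega>\<^sup>2 / \<omega>\<^sub>4 ^ 5 / 2 ^ l)"
      proof (rule sum_mono)
        fix k assume k: "k \<in> epoch l"
        then have "2 ^ l \<le> k" unfolding epoch_def by simp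
        then have "2 ^ l \<le> real k" by (simp only: numeral_power_le_of_nat_cancel_iff)
        have "lip k * (\<gamma> k)\<^sup>2 \<le> \<omega>\<^sup>2 / \<omega>\<^sub>4 ^ 5 / t k ^ 5"
          by (rule step_noise_le[OF a0 b0 t1[OF ge1[OF k]] lipt[OF ge1[OF k]] \<omega>' \<gamma>[OF ge1[OF k]]])
        also have "\<dots> \<le> \<omega>\<^sup>2 / \<omega>\<^sub>4 ^ 5 / 2 ^ l"
          unfolding t5[OF ge1[OF k]] using \<open>2 ^ l \<le> real k\<close> b0 ge1[OF k]
          by (intro divide_left_mono mult_pos_pos) auto
        finally show "lip k * (\<gamma> k)\<^sup>2 \<le> \<omega>\<^sup>2 / \<omega>\<^sub>4 ^ 5 / 2 ^ l" .
      qed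
      also have "\<dots> = \<omega>\<^sup>2 / \<omega>\<^sub>4 ^ 5" by (simp add: card_epoch)
      finally show ?thesis .
    qed
    finally show ?thesis unfolding C3_def by (simp add: mult_right_mono)
  qed
  \<comment> \<open>the factor \<open>1 / 8\<close> comes from \<open>t k \<le> 2 / s l\<close> on the epoch\<close>
  define c where "c = 2 / 5 * (\<omega> / (a + \<omega>\<^sub>4) ^ 3) / 8"
  have \<omega>0: "\<omega> > 0" unfolding \<omega>' using a0 b0 by simp
  have c0: "c > 0" unfolding c_def using \<omega>0 a0 b0 by simp
  define s where "s l = 1 / (2 ^ l) powr (1 / 5 :: real)" for l :: nat
  have s0: "s l > 0" for l unfolding s_def by simp
  have s5: "s l ^ 5 = 1 / 2 ^ l" for l unfolding s_def power_divide using fifth_root_power5[of "2 ^ l"] by simp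
  have ts: "1 / t k \<le> s l" "t k \<le> 2 / s l" if "k \<in> epoch l" for k l
    using epoch_fifth_root_bounds[OF that] unfolding s_def t_def by (simp_all add: frac_le)
  have Wge: "c / (s l)\<^sup>2 \<le> sum wt (epoch l)" if l: "l \<ge> 1" for l
  proof -
    have "2 / 5 * (\<omega> / (a + \<omega>\<^sub>4) ^ 3) / (2 / s l) ^ 3 \<le> wt k" if k: "k \<in> epoch l" for k
    proof -
      \<comment> \<open>\<open>k \<ge> 2\<close> gives \<open>t k ^ 10 \<ge> 4\<close>, which exceeds \<open>(5 / 4) ^ 5\<close>; index \<open>1\<close>, where the weight may vanish, is excluded by \<open>l \<ge> 1\<close>\<close>
      have "2 ^ 1 \<le> (2::nat) ^ l" using l by (intro power_increasing) auto
      then have k2: "k \<ge> 2" using k unfolding epoch_def by simp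
      then have k1: "k \<ge> 1" by simp
      have "5 / 4 \<le> (t k)\<^sup>2"
      proof (rule ccontr)
        assume "\<not> ?thesis"
        then have "((t k)\<^sup>2) ^ 5 \<le> (5 / 4) ^ 5" by (intro power_mono) auto
        moreover have "((t k)\<^sup>2) ^ 5 = (real k)\<^sup>2" unfolding t5[OF k1, symmetric] by (simp flip: power_mult)
        moreover have "2\<^sup>2 \<le> (real k)\<^sup>2" using k2 by (intro power_mono) auto
        ultimately show False by (simp add: power_divide)
      qed
      from step_weight_ge[OF a0 b0 t1[OF k1] lipt[OF k1] \<omega>' \<gamma>[OF k1] this]
      have "2 / 5 * (\<omega> / (a + \<omega>\<^sub>4) ^ 3) / t k ^ 3 \<le> wt k" unfolding wt_def .
      moreover have "2 / 5 * (\<omega> / (a + \<omega>\<^sub>4) ^ 3) / (2 / s l) ^ 3 \<le> 2 / 5 * (\<omega> / (a + \<omega>\<^sub>4) ^ 3) / t k ^ 3"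
        using ts(2)[OF k] t1[OF k1] \<omega>0 a0 b0 s0[of l]
        by (intro divide_left_mono power_mono mult_pos_pos) auto
      ultimately show ?thesis by simp
    qed
    then have "(\<Sum>k\<in>epoch l. 2 / 5 * (\<omega> / (a + \<omega>\<^sub>4) ^ 3) / (2 / s l) ^ 3) \<le> sum wt (epoch l)"
      by (rule sum_mono)
    moreover have "(\<Sum>k\<in>epoch l. 2 / 5 * (\<omega> / (a + \<omega>\<^sub>4) ^ 3) / (2 / s l) ^ 3) = c / (s l)\<^sup>2"
    proof -
      have "s l ^ 5 = s l ^ 3 * (s l)\<^sup>2" by (simp only: power_add[symmetric]) simp
      then have "2 ^ l * s l ^ 3 * (s l)\<^sup>2 = 2 ^ l * s l ^ 5" by (simp only: mult.assoc)
      also have "\<dots> = 1" unfolding s5 by simp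
      finally have cnt: "2 ^ l * s l ^ 3 = 1 / (s l)\<^sup>2"
        by (rule eq_divide_imp[rotated]) (use s0[of l] in simp)
      define X where "X = 2 / 5 * (\<omega> / (a + \<omega>\<^sub>4) ^ 3)"
      have "(\<Sum>k\<in>epoch l. X / (2 / s l) ^ 3) = X / 8 * (2 ^ l * s l ^ 3)"
        by (simp add: card_epoch power_divide)
      then show ?thesis unfolding cnt c_def X_def by simp
    qed
    ultimately show ?thesis by simp
  qed

  from linear_bounded_pos[OF linear_right_pinv[OF A(1,3)]]
  obtain K where K: "\<And>y. norm (right_pinv A y) \<le> K * norm y" "K \<ge> 0"
    using less_imp_le by metis
  define C2 where "C2 = 2 * K * lh * inverse (2 * \<rho>)"
  have C20: "C2 \<ge> 0" unfolding C2_def using K(2) lh h(1) by simp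
  have near: "norm (y - xh k y) \<le> C2 * s l" if k: "k \<in> epoch l" for k l y
  proof -
    have k1: "k \<ge> 1" using epoch_pos[OF k] .
    have "norm (y - xh k y) \<le> 2 * K * lh * \<mu> k"
      unfolding xh_def by (rule norm_prox_point_diff_le[OF f_smooth h(3,2) A(1) \<mu>0[OF k1] \<mu>\<rho>[OF k1] A(3) K])
    also have "\<dots> = C2 * (1 / t k)" unfolding \<mu>t[OF k1] C2_def by simp
    also have "\<dots> \<le> C2 * s l" using ts(1)[OF k] C20 by (rule mult_left_mono)
    finally show ?thesis .
  qed
  have q0: "0 \<le> q k y" for k y unfolding q_def stationarity_gap_def by (rule infdist_nonneg)
  have qle: "q k y \<le> norm (v k y) + lf * norm (y - xh k y)" if "k \<ge> 1" "y \<in> M" for k y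
    unfolding q_def v_def xh_def
    by (rule stationarity_gap_le[OF f_smooth h(3,2) A(1) \<mu>0[OF that(1)] \<mu>\<rho>[OF that(1)] A(3) sub[OF that(2)]])
  have qm: "q k \<in> borel_measurable N" if k: "k \<ge> 1" for k
    unfolding q_def[abs_def] xh_def N_def
    by (rule borel_measurable_stationarity_gap[OF f_smooth h(3,2) A(1) \<mu>0[OF k] \<mu>\<rho>[OF k] A(3) clM manifold(2)])
  have qint: "integrable P (\<lambda>w. q k (x k w))" if k: "k \<in> epoch l" for k l
  proof (rule bint)
    show k1: "k \<ge> 1" using epoch_pos[OF k] .
    show "q k \<in> borel_measurable N" by (rule qm[OF k1])
    fix y assume y: "y \<in> M"
    have "lf * norm (y - xh k y) \<le> lf * (C2 * s l)" using near[OF k] lf by (rule mult_left_mono)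
    then show "\<bar>q k y\<bar> \<le> G + lf * (C2 * s l)" using qle[OF k1 y] vn[OF k1 y] q0[of k y] by linarith
  qed
  define c' where "c' = 1 / 2 + lf * C2"
  define g where "g k = expectation (\<lambda>w. q k (x k w))" for k
  \<comment> \<open>the square is introduced by \<open>2 * s * r \<le> r\<^sup>2 + s\<^sup>2\<close>, because the descent inequality controls squared gradients\<close>
  have gle: "g k \<le> V k / (2 * s l) + c' * s l" if k: "k \<in> epoch l" for k l
  proof -
    have k1: "k \<ge> 1" using epoch_pos[OF k] .
    have pt: "q k (x k w) \<le> (norm (v k (x k w)))\<^sup>2 / (2 * s l) + c' * s l" if w: "w \<in> space P" for w
    proof -
      let ?r = "norm (v k (x k w))"
      have "2 * s l * ?r \<le> ?r\<^sup>2 + (s l)\<^sup>2"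
        using zero_le_power2[of "?r - s l"] by (simp add: power2_diff algebra_simps)
      then have "?r \<le> ?r\<^sup>2 / (2 * s l) + s l / 2"
        using s0[of l] by (simp add: field_simps power2_eq_square)
      moreover have "lf * norm (x k w - xh k (x k w)) \<le> lf * (C2 * s l)" using near[OF k] lf by (rule mult_left_mono)
      ultimately show ?thesis using qle[OF k1 xM[OF k1 w]] unfolding c'_def by (simp add: algebra_simps)
    qed
    have "g k \<le> expectation (\<lambda>w. (norm (v k (x k w)))\<^sup>2 / (2 * s l) + c' * s l)"
      unfolding g_def using Vint[OF k1] by (intro integral_mono pt qint[OF k]) auto
    also have "\<dots> = V k / (2 * s l) + c' * s l" unfolding V_def using Vint[OF k1] by (simp add: prob_space)
    finally show ?thesis .
  qed
  define p where "p l k = prob {w \<in> space P. R l w = k}" for l k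
  have p0: "0 \<le> p l k" for l k unfolding p_def by simp
  have pw: "p l k * sum wt (epoch l) = wt k" if "k \<in> epoch l" for l k
    using choices(2)[of l] that unfolding epoch_index_def p_def wt_def by blast
  have Rep: "R l w \<in> epoch l" if "w \<in> space P" for l w
    using choices(2)[of l] that unfolding epoch_index_def by blast
  have avg: "(\<Sum>k\<in>epoch l. p l k) = 1" "(\<Sum>k\<in>epoch l. p l k * g k) \<le> (C3 / (2 * c) + c') * s l" if "l \<ge> 1" for l
  proof -
    note average = weighted_average_le[where I="epoch l" and p="p l" and g=g and s="s l" and c'=c',
        OF card_epoch(1) wt0[OF epoch_pos[of _ l]] pw c0 s0 Wge[OF that] epoch_sum C30 gle]
    show "(\<Sum>k\<in>epoch l. p l k) = 1" by (rule average(1))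
    show "(\<Sum>k\<in>epoch l. p l k * g k) \<le> (C3 / (2 * c) + c') * s l" by (rule average(2))
  qed

  \<comment> \<open>splitting by the value of \<open>R l\<close>, independence turns the expected gap at the random index into the weighted average\<close>
  have random: "integrable P (\<lambda>w. q (R l w) (x (R l w) w))"
    "expectation (\<lambda>w. q (R l w) (x (R l w) w)) = (\<Sum>k\<in>epoch l. p l k * g k)" for l
  proof -
    have summand: "integrable P (\<lambda>w. indicator {k} (R l w) * q k (x k w))"
      "expectation (\<lambda>w. indicator {k} (R l w) * q k (x k w)) = p l k * g k" if k: "k \<in> epoch l" for k
    proof -
      have k1: "k \<ge> 1" using epoch_pos[OF k] .
      let ?X = "\<lambda>w. \<lambda>j\<in>{1..}. \<xi> j w" and ?Y = "\<lambda>w l. R l w"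
      let ?q = "\<lambda>s. q k (iterate \<Phi> x\<^sub>1 k s)"
      have X: "?X \<in> P \<rightarrow>\<^sub>M PiM {1..} (\<lambda>_. D)" using \<xi>m by (intro measurable_restrict) auto
      have Y: "?Y \<in> P \<rightarrow>\<^sub>M PiM UNIV (\<lambda>_. count_space UNIV)" using Rm by (intro measurable_PiM_single') auto
      have iq: "?q \<in> borel_measurable (PiM {1..} (\<lambda>_. D))"
        by (rule measurable_compose[OF measurable_iterate[OF aN \<Phi>] qm[OF k1]]) auto
      have eq: "q k (x k w) = ?q (?X w)" if "w \<in> space P" for w using it[OF k1 that] by simp
      have int: "integrable P (\<lambda>w. ?q (?X w))"
        using qint[OF k] by (subst (asm) Bochner_Integration.integrable_cong[OF refl eq])
      have r: "(\<lambda>y. y l) \<in> PiM UNIV (\<lambda>_. count_space UNIV) \<rightarrow>\<^sub>M count_space (UNIV :: nat set)"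
        by (rule measurable_component_singleton) simp
      have indS: "indep_set {?X -` B \<inter> space P | B. B \<in> sets (PiM {1..} (\<lambda>_. D))}
          {?Y -` B \<inter> space P | B. B \<in> sets (PiM UNIV (\<lambda>_. count_space UNIV))}"
        using choices(1) unfolding independent_choices_def by blast
      note ei = expectation_indep_index[where X="?X" and Y="?Y" and q="?q" and r="\<lambda>y. y l", OF X Y indS iq int r, of k]
      have eq2: "expectation (\<lambda>w. ?q (?X w)) = g k"
        unfolding g_def using eq by (intro Bochner_Integration.integral_cong) auto
      show "integrable P (\<lambda>w. indicator {k} (R l w) * q k (x k w))"
        using ei(1) by (subst Bochner_Integration.integrable_cong[OF refl]) (auto simp: eq)
      have "expectation (\<lambda>w. indicator {k} (R l w) * q k (x k w)) = expectation (\<lambda>w. indicator {k} (R l w) * ?q (?X w))"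
        using eq by (intro Bochner_Integration.integral_cong) auto
      then show "expectation (\<lambda>w. indicator {k} (R l w) * q k (x k w)) = p l k * g k"
        using ei(2) unfolding eq2 p_def by simp
    qed
    have split: "q (R l w) (x (R l w) w) = (\<Sum>k\<in>epoch l. indicator {k} (R l w) * q k (x k w))" if "w \<in> space P" for w
    proof -
      have "(\<Sum>k\<in>epoch l. indicator {k} (R l w) * q k (x k w)) = (\<Sum>k\<in>epoch l. if k = R l w then q k (x k w) else 0)"
        by (intro sum.cong) (auto simp: indicator_def)
      then show ?thesis using Rep[OF that] card_epoch(1) by simp
    qed
    show "integrable P (\<lambda>w. q (R l w) (x (R l w) w))"
      using summand(1) by (subst Bochner_Integration.integrable_cong[OF refl split]) auto
    have "expectation (\<lambda>w. q (R l w) (x (R l w) w)) = expectation (\<lambda>w. \<Sum>k\<in>epoch l. indicator {k} (R l w) * q k (x k w))"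
      using split by (intro Bochner_Integration.integral_cong) auto
    also have "\<dots> = (\<Sum>k\<in>epoch l. p l k * g k)"
      using summand by (subst Bochner_Integration.integral_sum) auto
    finally show "expectation (\<lambda>w. q (R l w) (x (R l w) w)) = (\<Sum>k\<in>epoch l. p l k * g k)" .
  qed

  define C0 where "C0 = max (C3 / (2 * c) + c') C2"
  have C00: "C0 > 0" unfolding C0_def c'_def using C30 c0 lf C20 by (intro max.strict_coboundedI1 add_nonneg_pos add_pos_nonneg) auto
  define C where "C = 4 * max 1 (C0 ^ 5)"
  show ?thesis
  proof (intro exI[of _ C] conjI allI impI)
    show "C > 0" unfolding C_def by simp
    fix \<epsilon> :: real assume \<epsilon>: "\<epsilon> > 0"
    obtain l where l: "l \<ge> 1" "(C0 / \<epsilon>) ^ 5 \<le> 2 ^ l" "2 ^ (l + 1) \<le> 4 * max 1 ((C0 / \<epsilon>) ^ 5)"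
      using exists_epoch_of_size[of "(C0 / \<epsilon>) ^ 5"] by blast
    have Cs: "C0 * s l \<le> \<epsilon>"
    proof -
      have "(C0 * s l) ^ 5 = C0 ^ 5 / 2 ^ l" unfolding power_mult_distrib s5 by simp
      also have "\<dots> \<le> \<epsilon> ^ 5" using l(2) \<epsilon> by (simp add: field_simps)
      finally show ?thesis using \<epsilon> power_le_imp_le_base[of "C0 * s l" 4 \<epsilon>] by simp
    qed
    have size: "real k \<le> C * max 1 (1 / \<epsilon> ^ 5)" if k: "k \<in> epoch l" for k
    proof -
      have "k \<le> 2 ^ (l + 1)" using k unfolding epoch_def by simp
      then have "real k \<le> 2 ^ (l + 1)" by (simp only: of_nat_le_numeral_power_cancel_iff)
      also have "\<dots> \<le> 4 * max 1 ((C0 / \<epsilon>) ^ 5)" by (rule l(3))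
      also have "(C0 / \<epsilon>) ^ 5 = C0 ^ 5 * (1 / \<epsilon> ^ 5)" by (simp add: power_divide)
      also have "max 1 (C0 ^ 5 * (1 / \<epsilon> ^ 5)) \<le> max 1 (C0 ^ 5) * max 1 (1 / \<epsilon> ^ 5)"
      proof (rule max.boundedI)
        show "1 \<le> max 1 (C0 ^ 5) * max 1 (1 / \<epsilon> ^ 5)"
          using mult_mono[of 1 "max 1 (C0 ^ 5)" 1 "max 1 (1 / \<epsilon> ^ 5)"] by simp
        show "C0 ^ 5 * (1 / \<epsilon> ^ 5) \<le> max 1 (C0 ^ 5) * max 1 (1 / \<epsilon> ^ 5)"
          using \<epsilon> by (intro mult_mono) auto
      qed
      finally show ?thesis unfolding C_def by simp
    qed
    have nearl: "norm (y - xh k y) \<le> \<epsilon>" if "k \<in> epoch l" for k y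
    proof -
      have "C2 * s l \<le> C0 * s l" unfolding C0_def using s0[of l] by (intro mult_right_mono) auto
      then show ?thesis using near[OF that, of y] Cs by linarith
    qed
    have avgl: "(\<Sum>k\<in>epoch l. p l k * g k) \<le> \<epsilon>"
    proof -
      have "(\<Sum>k\<in>epoch l. p l k * g k) \<le> (C3 / (2 * c) + c') * s l" using avg(2)[OF l(1)] .
      also have "\<dots> \<le> C0 * s l" unfolding C0_def using s0[of l] by (intro mult_right_mono) auto
      finally show ?thesis using Cs by linarith
    qed
    have "\<exists>k\<in>epoch l. g k \<le> \<epsilon>"
      using avg(1)[OF l(1)] p0 avgl by (intro exists_le_weighted_average[of "epoch l" "p l"] card_epoch) auto
    then obtain k where k: "k \<in> epoch l" "g k \<le> \<epsilon>" by blast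
    show "\<exists>l. \<exists>k\<in>epoch l. \<forall>k'\<in>{R l, \<lambda>_. k}.
      let x' = (\<lambda>w. x (k' w) w);
          xhat = (\<lambda>w. prox_point A h (\<mu> (k' w)) (x' w));
          gap = (\<lambda>w. stationarity_gap M f h A (x' w) (xhat w) (A (xhat w)))
      in (\<forall>w\<in>space P. real (k' w) \<le> C * max 1 (1 / \<epsilon> ^ 5)) \<and>
         integrable P gap \<and> (\<integral>w. gap w \<partial>P) \<le> \<epsilon> \<and>
         (\<forall>w\<in>space P. norm (x' w - xhat w) \<le> \<epsilon>)"
    proof (intro exI[of _ l] bexI[OF _ k(1)] ballI)
      fix k' assume "k' \<in> {R l, \<lambda>_. k}"
      then consider "k' = R l" | "k' = (\<lambda>_. k)" by blast
      then show "let x' = (\<lambda>w. x (k' w) w);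
          xhat = (\<lambda>w. prox_point A h (\<mu> (k' w)) (x' w));
          gap = (\<lambda>w. stationarity_gap M f h A (x' w) (xhat w) (A (xhat w)))
        in (\<forall>w\<in>space P. real (k' w) \<le> C * max 1 (1 / \<epsilon> ^ 5)) \<and>
           integrable P gap \<and> (\<integral>w. gap w \<partial>P) \<le> \<epsilon> \<and>
           (\<forall>w\<in>space P. norm (x' w - xhat w) \<le> \<epsilon>)"
      proof cases
        case 1
        then show ?thesis
          unfolding Let_def using random[of l] avgl size nearl Rep[of _ l] unfolding q_def xh_def by simp
      next
        case 2
        then show ?thesis
          unfolding Let_def using qint[OF k(1)] k size nearl unfolding g_def q_def xh_def by simp
      qed
    qed
  qed
qed

end
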